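(* The set $$\widehat{\mathcal G}=\{A(i;b,j)\mid i\in[1,p],\ j\in[0,p-b-1]\}\cup\{B(i,j)\mid i,j\in[1,p-1]\}\cup\{L(l;i,j)\mid l,i,j\in[1,p-1],\ i\le j,\ l<j\}$$ is a Gröbner basis for the first syzygy module $\mathcal N$ of the ideal $\wp$ with respect to the monomial order $>_{\mathcal M}$.
   Context: Setting. $\mathbb N$ is the set of non-negative integers and $[a,b]=\{i\in\mathbb{Z}\mid a\le i\le b\}$. Let $p\ge 2$, $d\ge1$, and let $0<m_0<m_1<\dots<m_p$ be integers with $m_i=m_0+id$ for $i\in[1,p]$, $m_0=ap+b$ with $a\ge1$ and $b\in[1,p]$, $\gcd(m_0,d)=1$, and assume $\{m_0,\dots,m_p\}$ is a minimal set of generators of the numerical semigroup $\Gamma=\sum_{i=0}^p\mathbb N m_i$. Let $K$ be a field, $R=K[X_1,\dots,X_p,X_0]$, and let $\wp$ be the kernel of the $K$-algebra homomorphism $\eta:R\to K[T]$, $\eta(X_i)=T^{m_i}$ for $i\in[0,p]$. Put $\epsilon(i,j)=i+j$ if $i+j<p$ and $\epsilon(i,j)=p$ if $i+j\ge p$; $\tau(i,j)=0$ if $i+j<p$ and $\tau(i,j)=p$ if $i+j\ge p$. Let $\phi(i,j)=X_iX_j-X_{\epsilon(i,j)}X_{i+j-\epsilon(i,j)}$ for $i,j\in[1,p-1]$ and $\psi(b,i)=X_{b+i}X_p^a-X_iX_0^{a+d}$ for $i\in[0,p-b]$. The set $\{\phi(i,j)\mid i,j\in[1,p-1]\}\cup\{\psi(b,i)\mid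 i\in[0,p-b]\}$ is a minimal generating set of $\wp$. Note $\phi(i,j)=\phi(j,i)$. Order on $R$. The weight of a monomial is given by $\omega(X_i)=m_i$ and $\omega(fg)=\omega(f)+\omega(g)$. For monomials $f=\prod_{i=1}^pX_i^{\alpha_i}X_0^{\alpha_0}$ and $g=\prod_{i=1}^pX_i^{\alpha_i'}X_0^{\alpha_0'}$, $f>_R g$ iff either $\omega(f)>\omega(g)$, or $\omega(f)=\omega(g)$ and the right-most non-zero entry of $(\alpha_1-\alpha_1',\dots,\alpha_p-\alpha_p',\alpha_0-\alpha_0')$ is negative. Syzygy module. Let $\mathcal M$ be the free $R$-module with basis the symbols $\Psi(b,i)$, $i\in[0,p-b]$, and $\Phi(i,j)$, $1\le i\le j\le p-1$. Let $\varphi$ be the $R$-linear map from $\mathcal M$ to $R$ with $\varphi(\Psi(b,i))=\psi(b,i)$ and $\varphi(\Phi(i,j))=\phi(i,j)$ (in the paper the values are multiplied by an auxiliary variable $t$, which does not affect the kernel). The first syzygy module of $\wp$ is $\mathcal N=\ker\varphi\subseteq\mathcal M$. Order on $\mathcal M$. Monomials of $\mathcal M$ are $\mathbb X^\alpha\mathbf e$ with $\mathbb X^\alpha$ a monomial of $R$ and $\mathbf e$ a basis symbol. Put $\varpi(\mathbb X^\alpha\Psi(b,i))=\mathbb X^\alpha X_p^aX_{b+i}$ and $\varpi(\mathbb X^\alpha\Phi(i,j))=\mathbb X^\alpha X_iX_j$. Then $\mathbb X^\alpha\mathbf e>_{\mathcal M}\mathbb X^{\alpha'}\mathbf e'$ iff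 either $\varpi(\mathbb X^\alpha\mathbf e)>_R\varpi(\mathbb X^{\alpha'}\mathbf e')$, or these are equal and one of the following holds: (i) $\mathbf e=\Psi(b,i)$, $\mathbf e'=\Psi(b,j)$ and $i<j$; (ii) $\mathbf e=\Psi(b,i)$ and $\mathbf e'=\Phi(l,j)$; (iii) $\mathbf e=\Phi(i,j)$, $\mathbf e'=\Phi(i',j')$ (with $i\le j$, $i'\le j'$) and either $j>j'$, or $j=j'$ and $i>i'$. The elements. In the following formulas set $\Phi(i,j)=\Phi(j,i)$, and $\Phi(i,j)=0$ unless both $i,j\in[1,p-1]$. $$A(i;b,j)=X_i\Psi(b,j)-X_{b+i+j-\epsilon(i,b+j)}\Psi(b,\epsilon(i,b+j)-b)-X_p^a\Phi(i,b+j)+X_0^{a+d}\big[\Phi(i,j)-\Phi(b+i+j-p,\,p-b)\big],$$ $$B(i,j)=X_iX_j\Psi(b,p-b)-X_{\epsilon(i,j)}X_{i+j-\epsilon(i,j)}\Psi(b,p-b)-\psi(b,p-b)\Phi(i,j),$$ $$L(l;i,j)=X_l\Phi(i,j)-X_j\Phi(i,l)+X_{\tau(i,j)}\Phi(i+j-\tau(i,j),\,l)-X_{\tau(i,l)}\Phi(i+l-\tau(i,l),\,j).$$ The leading terms with respect to $>_{\mathcal M}$ are the first terms written: $X_i\Psi(b,j)$, $X_iX_j\Psi(b,p-b)$, $X_l\Phi(i,j)$ respectively. A finite subset $G$ of $\mathcal N$ is a Gröbner basis of $\mathcal N$ if the leading terms of its elements generate the submodule generated by the leading terms of all nonzero elements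 of $\mathcal N$. *)

theory Defs
  imports "HOL-Library.Poly_Mapping" "HOL-Number_Theory.Cong" "HOL-Computational_Algebra.Polynomial"
begin

subsection \<open>The polynomial ring and the defining ideal\<close>

text \<open>
  A power product is an exponent vector \<open>nat \<Rightarrow>\<^sub>0 nat\<close>.  The polynomial type has variables
  \<open>X\<^sub>i\<close> for all natural numbers \<open>i\<close>; the ring \<open>K[X\<^sub>1,\<dots>,X\<^sub>p,X\<^sub>0]\<close> is its subring \<open>ring_R p\<close>,
  and all scalars below are taken from that subring.
\<close>

type_synonym mon = "nat \<Rightarrow>\<^sub>0 nat"
type_synonym 'k mpoly = "mon \<Rightarrow>\<^sub>0 'k"

definition mons_R :: "nat \<Rightarrow> mon set" where
  "mons_R p = {t. Poly_Mapping.keys t \<subseteq> {0..p}}"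

definition ring_R :: "nat \<Rightarrow> 'k::field mpoly set" where
  "ring_R p = {f. Poly_Mapping.keys f \<subseteq> mons_R p}"

definition var :: "nat \<Rightarrow> 'k::field mpoly" where
  "var i = Poly_Mapping.single (Poly_Mapping.single i 1) 1"

definition wt :: "(nat \<Rightarrow> nat) \<Rightarrow> mon \<Rightarrow> nat" where
  "wt m t = (\<Sum>i\<in>Poly_Mapping.keys t. Poly_Mapping.lookup t i * m i)"

text \<open>The substitution homomorphism \<open>X\<^sub>i \<mapsto> T ^ m\<^sub>i\<close>, and its kernel.\<close>

definition eta :: "(nat \<Rightarrow> nat) \<Rightarrow> 'k::field mpoly \<Rightarrow> 'k poly" where
  "eta m f = (\<Sum>t\<in>Poly_Mapping.keys f. smult (Poly_Mapping.lookup f t)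
      (\<Prod>i\<in>Poly_Mapping.keys t. monom 1 (m i) ^ Poly_Mapping.lookup t i))"

definition wp :: "nat \<Rightarrow> (nat \<Rightarrow> nat) \<Rightarrow> 'k::field mpoly set" where
  "wp p m = {f \<in> ring_R p. eta m f = 0}"

definition numerical_span :: "nat set \<Rightarrow> nat set" where
  "numerical_span S = range (\<lambda>c. \<Sum>s\<in>S. c s * s)"

definition minimal_generators :: "nat set \<Rightarrow> bool" where
  "minimal_generators S \<longleftrightarrow> (\<forall>S'. S' \<subset> S \<longrightarrow> numerical_span S' \<noteq> numerical_span S)"


subsection \<open>The generators of the ideal\<close>

definition eps :: "nat \<Rightarrow> nat \<Rightarrow> nat \<Rightarrow> nat" where
  "eps p i j = (if i + j < p then i + j else p)"

definition tau :: "nat \<Rightarrow> nat \<Rightarrow> nat \<Rightarrow> nat" where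
  "tau p i j = (if i + j < p then 0 else p)"

definition phi :: "nat \<Rightarrow> nat \<Rightarrow> nat \<Rightarrow> 'k::field mpoly" where
  "phi p i j = var i * var j - var (eps p i j) * var (i + j - eps p i j)"

definition psi :: "nat \<Rightarrow> nat \<Rightarrow> nat \<Rightarrow> nat \<Rightarrow> nat \<Rightarrow> 'k::field mpoly" where
  "psi p d a b i = var (b + i) * var p ^ a - var i * var 0 ^ (a + d)"


subsection \<open>The free module and the first syzygy module\<close>

text \<open>The basis symbol \<open>\<Psi>(b,i)\<close> is written \<open>Psi i\<close>, as \<open>b\<close> is fixed.\<close>

datatype symb = Psi nat | Phi nat nat

type_synonym 'k vec = "symb \<Rightarrow>\<^sub>0 'k mpoly"

definition symbs :: "nat \<Rightarrow> nat \<Rightarrow> symb set" where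
  "symbs p b = {Psi i | i. i \<le> p - b} \<union> {Phi i j | i j. 1 \<le> i \<and> i \<le> j \<and> j \<le> p - 1}"

definition free_module :: "nat \<Rightarrow> nat \<Rightarrow> 'k::field vec set" where
  "free_module p b = {v. Poly_Mapping.keys v \<subseteq> symbs p b \<and>
                         (\<forall>e. Poly_Mapping.lookup v e \<in> ring_R p)}"

definition scale :: "'k::field mpoly \<Rightarrow> 'k vec \<Rightarrow> 'k vec" (infixr \<open>*m\<close> 75) where
  "f *m v = Poly_Mapping.map (\<lambda>g. f * g) v"

fun gen_val :: "nat \<Rightarrow> nat \<Rightarrow> nat \<Rightarrow> nat \<Rightarrow> symb \<Rightarrow> 'k::field mpoly" where
  "gen_val p d a b (Psi i) = psi p d a b i"
| "gen_val p d a b (Phi i j) = phi p i j"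

text \<open>The \<open>R\<close>-linear map \<open>\<phi>\<close> from the free module to \<open>R\<close> sending each symbol to its generator;
  its kernel is the first syzygy module of the ideal (the generators do generate \<open>wp p m\<close>,
  see \<open>wp_generated\<close> at the end).\<close>

definition gen_map :: "nat \<Rightarrow> nat \<Rightarrow> nat \<Rightarrow> nat \<Rightarrow> 'k::field vec \<Rightarrow> 'k mpoly" where
  "gen_map p d a b v = (\<Sum>e\<in>Poly_Mapping.keys v. Poly_Mapping.lookup v e * gen_val p d a b e)"

definition syzygy_module :: "nat \<Rightarrow> nat \<Rightarrow> nat \<Rightarrow> nat \<Rightarrow> 'k::field vec set" where
  "syzygy_module p d a b = {v \<in> free_module p b. gen_map p d a b v = 0}"


subsection \<open>The monomial orders\<close>

text \<open>Exponent vectors are read in the order \<open>\<alpha>\<^sub>1,\<dots>,\<alpha>\<^sub>p,\<alpha>\<^sub>0\<close>, so the entry of \<open>X\<^sub>0\<close> is the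
  right-most one; \<open>right_of p k\<close> are the positions to the right of that of \<open>X\<^sub>k\<close>.\<close>

definition right_of :: "nat \<Rightarrow> nat \<Rightarrow> nat set" where
  "right_of p k = (if k = 0 then {} else insert 0 {k<..p})"

definition gr_R :: "nat \<Rightarrow> (nat \<Rightarrow> nat) \<Rightarrow> mon \<Rightarrow> mon \<Rightarrow> bool" where
  "gr_R p m f g \<longleftrightarrow> wt m f > wt m g \<or>
     wt m f = wt m g \<and>
     (\<exists>k\<le>p. int (Poly_Mapping.lookup f k) - int (Poly_Mapping.lookup g k) < 0 \<and>
        (\<forall>i\<in>right_of p k. int (Poly_Mapping.lookup f i) - int (Poly_Mapping.lookup g i) = 0))"

text \<open>A monomial \<open>X\<^sup>\<alpha> e\<close> of the free module is the pair \<open>(\<alpha>, e)\<close>.\<close>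

fun varpi :: "nat \<Rightarrow> nat \<Rightarrow> nat \<Rightarrow> mon \<times> symb \<Rightarrow> mon" where
  "varpi p a b (t, Psi i) = t + Poly_Mapping.single p a + Poly_Mapping.single (b + i) 1"
| "varpi p a b (t, Phi i j) = t + Poly_Mapping.single i 1 + Poly_Mapping.single j 1"

fun gr_symb :: "symb \<Rightarrow> symb \<Rightarrow> bool" where
  "gr_symb (Psi i) (Psi j) \<longleftrightarrow> i < j"
| "gr_symb (Psi i) (Phi l j) \<longleftrightarrow> True"
| "gr_symb (Phi l j) (Psi i) \<longleftrightarrow> False"
| "gr_symb (Phi i j) (Phi i' j') \<longleftrightarrow> j > j' \<or> j = j' \<and> i > i'"

definition gr_M :: "nat \<Rightarrow> nat \<Rightarrow> nat \<Rightarrow> (nat \<Rightarrow> nat) \<Rightarrow> mon \<times> symb \<Rightarrow> mon \<times> symb \<Rightarrow> bool" where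
  "gr_M p a b m u u' \<longleftrightarrow> gr_R p m (varpi p a b u) (varpi p a b u') \<or>
     varpi p a b u = varpi p a b u' \<and> gr_symb (snd u) (snd u')"


subsection \<open>Leading terms and Groebner bases\<close>

definition supp_M :: "'k::field vec \<Rightarrow> (mon \<times> symb) set" where
  "supp_M v = {(t, e). Poly_Mapping.lookup (Poly_Mapping.lookup v e) t \<noteq> 0}"

definition lead_mon :: "nat \<Rightarrow> nat \<Rightarrow> nat \<Rightarrow> (nat \<Rightarrow> nat) \<Rightarrow> 'k::field vec \<Rightarrow> mon \<times> symb" where
  "lead_mon p a b m v =
     (THE u. u \<in> supp_M v \<and> (\<forall>u'\<in>supp_M v. u' \<noteq> u \<longrightarrow> gr_M p a b m u u'))"

definition lead_term :: "nat \<Rightarrow> nat \<Rightarrow> nat \<Rightarrow> (nat \<Rightarrow> nat) \<Rightarrow> 'k::field vec \<Rightarrow> 'k vec" where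
  "lead_term p a b m v = (if v = 0 then 0 else
     (let (t, e) = lead_mon p a b m v in
        Poly_Mapping.single e
          (Poly_Mapping.single t (Poly_Mapping.lookup (Poly_Mapping.lookup v e) t))))"

definition is_submodule :: "nat \<Rightarrow> nat \<Rightarrow> 'k::field vec set \<Rightarrow> bool" where
  "is_submodule p b N \<longleftrightarrow> N \<subseteq> free_module p b \<and> 0 \<in> N \<and>
     (\<forall>v\<in>N. \<forall>w\<in>N. v + w \<in> N) \<and> (\<forall>f\<in>ring_R p. \<forall>v\<in>N. f *m v \<in> N)"

definition groebner_basis ::
  "nat \<Rightarrow> nat \<Rightarrow> nat \<Rightarrow> (nat \<Rightarrow> nat) \<Rightarrow> 'k::field vec set \<Rightarrow> 'k vec set \<Rightarrow> bool" where
  "groebner_basis p a b m N G \<longleftrightarrow> finite G \<and> G \<subseteq> N \<and>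
     is_submodule p b hull (lead_term p a b m ` G) =
     is_submodule p b hull (lead_term p a b m ` (N - {0}))"


subsection \<open>The elements A, B and L\<close>

text \<open>
  \<open>PsiV i\<close> and \<open>PhiV p i j\<close> are the basis vectors, the latter with the conventions
  \<open>\<Phi>(i,j) = \<Phi>(j,i)\<close>, and \<open>\<Phi>(i,j) = 0\<close> unless \<open>i\<close> and \<open>j\<close> lie in \<open>[1,p-1]\<close>.  In \<open>A_syz\<close> the
  index \<open>b + i + j - p\<close> may be negative; natural subtraction then gives \<open>0\<close>, which is outside
  \<open>[1,p-1]\<close> as well.  No other subtraction is truncated in the relevant ranges.
\<close>

definition PsiV :: "nat \<Rightarrow> 'k::field vec" where
  "PsiV i = Poly_Mapping.single (Psi i) 1"

definition PhiV :: "nat \<Rightarrow> nat \<Rightarrow> nat \<Rightarrow> 'k::field vec" where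
  "PhiV p i j = (if i \<in> {1..p - 1} \<and> j \<in> {1..p - 1}
     then Poly_Mapping.single (Phi (min i j) (max i j)) 1 else 0)"

definition A_syz :: "nat \<Rightarrow> nat \<Rightarrow> nat \<Rightarrow> nat \<Rightarrow> nat \<Rightarrow> nat \<Rightarrow> 'k::field vec" where
  "A_syz p d a b i j =
     var i *m PsiV j
     - var (b + i + j - eps p i (b + j)) *m PsiV (eps p i (b + j) - b)
     - var p ^ a *m PhiV p i (b + j)
     + var 0 ^ (a + d) *m (PhiV p i j - PhiV p (b + i + j - p) (p - b))"

definition B_syz :: "nat \<Rightarrow> nat \<Rightarrow> nat \<Rightarrow> nat \<Rightarrow> nat \<Rightarrow> nat \<Rightarrow> 'k::field vec" where
  "B_syz p d a b i j =
     (var i * var j) *m PsiV (p - b)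
     - (var (eps p i j) * var (i + j - eps p i j)) *m PsiV (p - b)
     - psi p d a b (p - b) *m PhiV p i j"

definition L_syz :: "nat \<Rightarrow> nat \<Rightarrow> nat \<Rightarrow> nat \<Rightarrow> 'k::field vec" where
  "L_syz p l i j =
     var l *m PhiV p i j
     - var j *m PhiV p i l
     + var (tau p i j) *m PhiV p (i + j - tau p i j) l
     - var (tau p i l) *m PhiV p (i + l - tau p i l) j"


subsection \<open>The generators generate the ideal\<close>

definition is_ideal :: "nat \<Rightarrow> 'k::field mpoly set \<Rightarrow> bool" where
  "is_ideal p I \<longleftrightarrow> I \<subseteq> ring_R p \<and> 0 \<in> I \<and>
     (\<forall>f\<in>I. \<forall>g\<in>I. f + g \<in> I) \<and> (\<forall>r\<in>ring_R p. \<forall>f\<in>I. r * f \<in> I)"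

lemma mpoly_expand:
  fixes f :: "'k::field mpoly"
  shows "f = (\<Sum>t\<in>Poly_Mapping.keys f. Poly_Mapping.single t (Poly_Mapping.lookup f t))"
proof (rule poly_mapping_eqI)
  fix k
  show "Poly_Mapping.lookup f k = Poly_Mapping.lookup
      (\<Sum>t\<in>Poly_Mapping.keys f. Poly_Mapping.single t (Poly_Mapping.lookup f t)) k"
    by (cases "k \<in> Poly_Mapping.keys f")
      (auto simp: lookup_sum lookup_single when_def in_keys_iff sum.delta)
qed

lemma wt_superset:
  "finite A \<Longrightarrow> Poly_Mapping.keys t \<subseteq> A \<Longrightarrow> wt m t = (\<Sum>i\<in>A. Poly_Mapping.lookup t i * m i)"
  unfolding wt_def by (rule sum.mono_neutral_left) (auto simp: in_keys_iff)

lemma wt_add: "wt m (s + t) = wt m s + wt m t"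
proof -
  let ?A = "Poly_Mapping.keys s \<union> Poly_Mapping.keys t"
  have "Poly_Mapping.keys (s + t) \<subseteq> ?A" by (rule Poly_Mapping.keys_add)
  then show ?thesis
    by (simp add: wt_superset[of ?A] lookup_add distrib_right sum.distrib)
qed

lemma wt_single: "wt m (Poly_Mapping.single i n) = n * m i"
  by (simp add: wt_superset[of "{i}"])

lemma eta_mon: "(\<Prod>i\<in>Poly_Mapping.keys t. monom (1::'k::field) (m i) ^ Poly_Mapping.lookup t i)
    = monom 1 (wt m t)"
proof -
  have "(\<Prod>i\<in>A. monom (1::'k) (m i) ^ Poly_Mapping.lookup t i)
    = monom 1 (\<Sum>i\<in>A. Poly_Mapping.lookup t i * m i)" if "finite A" for A
    using that by (induction A) (auto simp: monom_power mult_monom mult.commute one_pCons monom_0)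
  then show ?thesis by (simp add: wt_def)
qed

lemma eta_superset:
  "finite A \<Longrightarrow> Poly_Mapping.keys f \<subseteq> A \<Longrightarrow> 
   eta m f = (\<Sum>t\<in>A. monom (Poly_Mapping.lookup f t) (wt m t))"
  unfolding eta_def eta_mon smult_monom mult_1_right
  by (rule sum.mono_neutral_left) (auto simp: in_keys_iff)

lemma eta_add: "eta m (f + g) = eta m f + eta m g"
proof -
  let ?A = "Poly_Mapping.keys f \<union> Poly_Mapping.keys g"
  have "Poly_Mapping.keys (f + g) \<subseteq> ?A" by (rule Poly_Mapping.keys_add)
  then show ?thesis
    by (simp add: eta_superset[of ?A] lookup_add add_monom[symmetric] sum.distrib)
qed

lemma eta_zero: "eta m 0 = 0"
  by (simp add: eta_def)

lemma eta_sum: "eta m (\<Sum>x\<in>A. f x) = (\<Sum>x\<in>A. eta m (f x))"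
  by (induction A rule: infinite_finite_induct) (auto simp: eta_zero eta_add)

lemma eta_single: "eta m (Poly_Mapping.single t c) = monom c (wt m t)"
  by (simp add: eta_superset[of "{t}"])

lemma eta_mult: "eta m (f * g) = eta m f * eta m g"
proof -
  have "f * g = (\<Sum>s\<in>Poly_Mapping.keys f. \<Sum>t\<in>Poly_Mapping.keys g.
     Poly_Mapping.single (s + t) (Poly_Mapping.lookup f s * Poly_Mapping.lookup g t))"
    by (subst mpoly_expand[of f], subst mpoly_expand[of g])
      (simp add: sum_product mult_single)
  then show ?thesis
    by (simp add: eta_sum eta_single eta_superset[of "Poly_Mapping.keys f" f]
        eta_superset[of "Poly_Mapping.keys g" g] sum_product mult_monom wt_add)
qed

lemma var_power: "var i ^ n = Poly_Mapping.single (Poly_Mapping.single i n) 1"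
  by (induction n) (auto simp: var_def mult_single single_add[symmetric])

lemma mons_R_add: "s \<in> mons_R p \<Longrightarrow> t \<in> mons_R p \<Longrightarrow> s + t \<in> mons_R p"
  using Poly_Mapping.keys_add[of s t] by (auto simp: mons_R_def)

lemma mons_R_single: "i \<le> p \<Longrightarrow> Poly_Mapping.single i n \<in> mons_R p"
  by (auto simp: mons_R_def)

lemma ring_R_single: "t \<in> mons_R p \<Longrightarrow> Poly_Mapping.single t c \<in> ring_R p"
  by (auto simp: ring_R_def)

lemma ring_R_add: "f \<in> ring_R p \<Longrightarrow> g \<in> ring_R p \<Longrightarrow> f + g \<in> ring_R p"
  using Poly_Mapping.keys_add[of f g] by (auto simp: ring_R_def)

lemma ring_R_diff: "f \<in> ring_R p \<Longrightarrow> g \<in> ring_R p \<Longrightarrow> f - g \<in> ring_R p"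
  using Poly_Mapping.keys_diff[of f g] by (auto simp: ring_R_def)

lemma ring_R_mult: "f \<in> ring_R p \<Longrightarrow> g \<in> ring_R p \<Longrightarrow> f * g \<in> ring_R p"
  using Poly_Mapping.keys_mult[of f g] mons_R_add by (fastforce simp: ring_R_def)

lemma ring_R_zero: "0 \<in> ring_R p"
  by (simp add: ring_R_def)

lemma is_ideal_hull: "S \<subseteq> ring_R p \<Longrightarrow> is_ideal p (is_ideal p hull S)"
proof -
  assume S: "S \<subseteq> ring_R p"
  have "is_ideal p (ring_R p)"
    by (simp add: is_ideal_def ring_R_add ring_R_mult ring_R_zero)
  with S have "is_ideal p hull S \<subseteq> ring_R p" by (intro hull_minimal)
  then show ?thesis
    unfolding is_ideal_def by (auto simp: hull_def is_ideal_def)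
qed

theorem wp_generated:
  assumes "p \<ge> 2" and "d \<ge> 1" and "0 < m 0"
    and m: "\<forall>i\<in>{1..p}. m i = m 0 + i * d"
    and m0: "m 0 = a * p + b" and a: "a \<ge> 1" and b: "b \<in> {1..p}"
    and cop: "gcd (m 0) d = 1"
  shows "wp p m = is_ideal p hull
    ({phi p i j | i j. i \<in> {1..p - 1} \<and> j \<in> {1..p - 1}} \<union>
     {psi p d a b i | i. i \<in> {0..p - b}} :: 'k::field mpoly set)"
    (is "_ = is_ideal p hull ?S")
proof
  let ?x = "\<lambda>i::nat. Poly_Mapping.single i (1::nat)"
  let ?X = "\<lambda>t. Poly_Mapping.single t (1::'k)"
  have wm: "m i = m 0 + i * d" if "i \<le> p" for i
    using that m by (cases "i = 0") auto
  have varR: "(var i :: 'k mpoly) ^ n \<in> ring_R p" if "i \<le> p" for i n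
    using that by (simp add: var_power ring_R_single mons_R_single)
  have var1R: "(var i :: 'k mpoly) \<in> ring_R p" if "i \<le> p" for i
    using varR[OF that, of 1] by simp
  have SR: "?S \<subseteq> ring_R p"
  proof
    fix f assume "f \<in> ?S"
    then consider i j where "i \<in> {1..p-1}" "j \<in> {1..p-1}" "f = phi p i j"
      | i where "i \<le> p - b" "f = psi p d a b i" by auto
    then show "f \<in> ring_R p"
    proof cases
      case 1 then show ?thesis
        by (auto simp: phi_def eps_def intro!: ring_R_diff ring_R_mult var1R)
    next
      case 2 then show ?thesis using b
        by (auto simp: psi_def intro!: ring_R_diff ring_R_mult var1R varR)
    qed
  qed
  define I where "I = is_ideal p hull ?S"
  have idI: "is_ideal p I" using is_ideal_hull[OF SR] by (simp add: I_def)
  have SI: "?S \<subseteq> I" by (simp add: I_def hull_subset)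
  have IR: "I \<subseteq> ring_R p" and I0: "0 \<in> I"
    and Iadd: "\<And>f g. f \<in> I \<Longrightarrow> g \<in> I \<Longrightarrow> f + g \<in> I"
    and Imul: "\<And>r f. r \<in> ring_R p \<Longrightarrow> f \<in> I \<Longrightarrow> r * f \<in> I"
    using idI by (auto simp: is_ideal_def)
  have zeroR: "0 \<in> mons_R p" by (simp add: mons_R_def)
  have Isum: "(\<Sum>x\<in>A. f x) \<in> I" if "\<And>x. x \<in> A \<Longrightarrow> f x \<in> I" for A and f :: "mon \<Rightarrow> 'k mpoly"
    using that by (induction A rule: infinite_finite_induct) (auto simp: I0 Iadd)
  have Imin: "- f \<in> I" if "f \<in> I" for f
  proof -
    have "Poly_Mapping.single 0 (-1) * f \<in> I"
      using Imul[OF ring_R_single[OF zeroR] that] .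
    also have "Poly_Mapping.single 0 (-1) * f = - f"
      by (simp add: single_uminus)
    finally show ?thesis .
  qed

  show "is_ideal p hull ?S \<subseteq> wp p m"
  proof (rule hull_minimal)
    show "is_ideal p (wp p m)"
      by (auto simp: is_ideal_def wp_def ring_R_add ring_R_mult ring_R_zero eta_add eta_mult eta_zero)
    have ev: "eta m (var i :: 'k mpoly) = monom 1 (m i)" for i
      by (simp add: var_def eta_single wt_single)
    have evp: "eta m (var i ^ n :: 'k mpoly) = monom 1 (n * m i)" for i n
      by (simp add: var_power eta_single wt_single)
    have ed: "eta m (f - g :: 'k mpoly) = eta m f - eta m g" for f g
      using eta_add[of m "f - g" g] by simp
    show "?S \<subseteq> wp p m"
    proof
      fix f assume f: "f \<in> ?S"
      then consider i j where "i \<in> {1..p-1}" "j \<in> {1..p-1}" "f = phi p i j"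
        | i where "i \<le> p - b" "f = psi p d a b i" by auto
      then have "eta m f = 0"
      proof cases
        case 1
        then have le: "i \<le> p" "j \<le> p" "eps p i j \<le> p" "i + j - eps p i j \<le> p"
          and "i + j = eps p i j + (i + j - eps p i j)"
          by (auto simp: eps_def)
        then have "i * d + j * d = eps p i j * d + (i + j - eps p i j) * d"
          by (metis distrib_right)
        then have "m i + m j = m (eps p i j) + m (i + j - eps p i j)"
          unfolding wm[OF le(1)] wm[OF le(2)] wm[OF le(3)] wm[OF le(4)] by linarith
        then show ?thesis using 1 by (simp add: phi_def ed eta_mult ev mult_monom)
      next
        case 2
        then have "m (b + i) + a * m p = m i + (a + d) * m 0"
        proof -
          have le: "b + i \<le> p" "i \<le> p" using 2 b by auto
          have "b * d + a * p * d = m 0 * d" by (simp add: m0 algebra_simps)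
          then show ?thesis
            unfolding wm[OF le(1)] wm[OF le(2)] wm[OF order_refl] by (simp add: algebra_simps)
        qed
        then show ?thesis using 2 by (simp add: psi_def ed eta_mult ev evp mult_monom)
      qed
      with f SR show "f \<in> wp p m" by (auto simp: wp_def)
    qed
  qed

  define eqv where "eqv s t \<longleftrightarrow> ?X s - ?X t \<in> I" for s t
  have eqv_refl: "eqv t t" for t by (simp add: eqv_def I0)
  have eqv_trans: "eqv r t" if "eqv r s" "eqv s t" for r s t
    using Iadd[of "?X r - ?X s" "?X s - ?X t"] that by (simp add: eqv_def)
  have eqv_sym: "eqv t s" if "eqv s t" for s t
    using Imin that by (fastforce simp: eqv_def)
  have eqv_add: "eqv (r + s) (r + t)" if "eqv s t" "r \<in> mons_R p" for r s t
    using Imul[OF ring_R_single[OF that(2)], of "?X s - ?X t" 1] that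
    by (simp add: eqv_def right_diff_distrib mult_single)
  have eqv_phi: "eqv (?x i + ?x j) (?x (eps p i j) + ?x (i + j - eps p i j))"
    if "i \<in> {1..p-1}" "j \<in> {1..p-1}" for i j
  proof -
    have "phi p i j \<in> I" using SI that by auto
    then show ?thesis by (simp add: eqv_def phi_def var_def mult_single)
  qed
  have eqv_psi: "eqv (?x (b + i) + Poly_Mapping.single p a) (?x i + Poly_Mapping.single 0 (a + d))"
    if "i \<le> p - b" for i
  proof -
    have "psi p d a b i \<in> I" using SI that by auto
    then show ?thesis by (simp add: eqv_def psi_def var_power) (simp add: var_def mult_single)
  qed

  have sS: "Poly_Mapping.single q (Suc n) = ?x q + Poly_Mapping.single q n" for q n :: nat
    by (simp flip: single_add)
  define N where "N c k i = Poly_Mapping.single 0 c + Poly_Mapping.single p k +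
      (if i = 0 then 0 else ?x i)" for c k i
  have NR: "N c k i \<in> mons_R p" if "i < p" for c k i
    using that by (auto simp: N_def intro!: mons_R_add mons_R_single zeroR)
  have addvar: "\<exists>c' k' i'. i' < p \<and> k' \<le> Suc k \<and> eqv (N c k i + ?x j) (N c' k' i')"
    if i: "i < p" and j: "j \<le> p" for c k i j
  proof -
    consider "j = 0" | "j = p" | "1 \<le> j" "j < p" "i = 0"
      | "1 \<le> j" "j < p" "1 \<le> i" using j by linarith
    then show ?thesis
    proof cases
      case 1
      have "N c k i + ?x j = N (Suc c) k i"
        by (simp add: N_def 1 sS[of 0 c] ac_simps)
      then show ?thesis using i eqv_refl by (metis le_SucI order_refl)
    next
      case 2
      have "N c k i + ?x j = N c (Suc k) i"
        by (simp add: N_def 2 sS[of p k] ac_simps)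
      then show ?thesis using i eqv_refl by (metis order_refl)
    next
      case 3
      then have "N c k i + ?x j = N c k j" by (simp add: N_def)
      then show ?thesis using 3 eqv_refl by (metis le_SucI order_refl)
    next
      case 4
      let ?r = "Poly_Mapping.single 0 c + Poly_Mapping.single p k"
      have rR: "?r \<in> mons_R p" by (intro mons_R_add mons_R_single) auto
      have "eqv (?r + (?x i + ?x j)) (?r + (?x (eps p i j) + ?x (i + j - eps p i j)))"
        using 4 i by (intro eqv_add[OF eqv_phi rR]) auto
      also have "?r + (?x i + ?x j) = N c k i + ?x j"
        using 4 by (simp add: N_def ac_simps)
      finally have e: "eqv (N c k i + ?x j) (?r + (?x (eps p i j) + ?x (i + j - eps p i j)))" .
      consider "i + j < p" | "i + j = p" | "i + j > p" by linarith
      then show ?thesis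
      proof cases
        case 1
        then have "?r + (?x (eps p i j) + ?x (i + j - eps p i j)) = N (Suc c) k (i + j)"
          using 4 by (simp add: N_def eps_def sS[of 0 c] ac_simps)
        then show ?thesis using e 1 by (metis le_SucI order_refl)
      next
        case 2
        then have "?r + (?x (eps p i j) + ?x (i + j - eps p i j)) = N (Suc c) (Suc k) 0"
          using 4 by (simp add: N_def eps_def sS[of 0 c] sS[of p k] ac_simps)
        then show ?thesis using e assms(1) by (metis order_refl less_le_trans pos2)
      next
        case 3
        then have "?r + (?x (eps p i j) + ?x (i + j - eps p i j)) = N c (Suc k) (i + j - p)"
          by (simp add: N_def eps_def sS[of p k] ac_simps)
        moreover have "i + j - p < p" using i 4 by linarith
        ultimately show ?thesis using e by (metis order_refl)
      qed
    qed
  qed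
  have red: "\<exists>c' k' i'. i' < p \<and> k' * p + i' < m 0 \<and> eqv (N c k i) (N c' k' i')"
    if "i < p" for c k i
    using that
  proof (induction k arbitrary: c i rule: less_induct)
    case (less k)
    consider "k * p + i < m 0" | "k = a" "b \<le> i" | "k > a"
    proof -
      have "k * p + i < m 0" if "\<not> (k = a \<and> b \<le> i)" "\<not> k > a"
      proof (cases "k = a")
        case True then show ?thesis using that m0 by auto
      next
        case False
        then have "Suc k \<le> a" using that by auto
        then have "Suc k * p \<le> a * p" by (rule mult_le_mono1)
        then show ?thesis using less.prems m0 by auto
      qed
      then show ?thesis using that by blast
    qed
    then show ?case
    proof cases
      case 1 then show ?thesis using less.prems eqv_refl by blast
    next
      case 2
      have "eqv (Poly_Mapping.single 0 c + (?x (b + (i - b)) + Poly_Mapping.single p a))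
          (Poly_Mapping.single 0 c + (?x (i - b) + Poly_Mapping.single 0 (a + d)))"
        using less.prems by (intro eqv_add eqv_psi mons_R_single) auto
      also have "Poly_Mapping.single 0 c + (?x (b + (i - b)) + Poly_Mapping.single p a) = N c k i"
        using 2 b by (auto simp: N_def ac_simps)
      also have "Poly_Mapping.single 0 c + (?x (i - b) + Poly_Mapping.single 0 (a + d))
          = N (c + (a + d)) 0 0 + ?x (i - b)"
        by (simp add: N_def single_add ac_simps)
      finally have e: "eqv (N c k i) (N (c + (a + d)) 0 0 + ?x (i - b))" .
      have e2: "\<exists>c'. N (c + (a + d)) 0 0 + ?x (i - b) = N c' 0 (i - b)"
      proof (cases "i \<le> b")
        case True
        then have "N (c + (a + d)) 0 0 + ?x (i - b) = N (Suc (c + (a + d))) 0 (i - b)"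
          using sS[of 0 "c + (a + d)"] by (simp add: N_def add.commute)
        then show ?thesis by blast
      qed (auto simp: N_def)
      then obtain c' where "eqv (N c k i) (N c' 0 (i - b))" using e by auto
      moreover have "i - b < p" using less.prems by auto
      ultimately show ?thesis
        using less.IH[of 0 "i - b" c'] a 2 eqv_trans by (metis less_le_trans zero_less_one)
    next
      case 3
      let ?r = "N c (k - a - 1) i"
      have "eqv (?r + (?x (b + (p - b)) + Poly_Mapping.single p a))
          (?r + (?x (p - b) + Poly_Mapping.single 0 (a + d)))"
        using less.prems by (intro eqv_add eqv_psi NR) auto
      also have "?r + (?x (b + (p - b)) + Poly_Mapping.single p a) = N c k i"
      proof -
        have "Poly_Mapping.single p k = Poly_Mapping.single p (k - a - 1) + (?x p + Poly_Mapping.single p a)"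
          using 3 by (simp flip: single_add)
        then show ?thesis using b by (simp add: N_def ac_simps)
      qed
      also have "?r + (?x (p - b) + Poly_Mapping.single 0 (a + d))
          = N (c + (a + d)) (k - a - 1) i + ?x (p - b)"
        by (simp add: N_def single_add ac_simps)
      finally have e: "eqv (N c k i) (N (c + (a + d)) (k - a - 1) i + ?x (p - b))" .
      obtain c' k' i' where *: "i' < p" "k' \<le> Suc (k - a - 1)"
        "eqv (N (c + (a + d)) (k - a - 1) i + ?x (p - b)) (N c' k' i')"
        using addvar[OF less.prems, of "p - b" "k - a - 1" "c + (a + d)"] by auto
      have "k' < k" using * 3 a by linarith
      then show ?thesis using less.IH[of k' i' c'] * e eqv_trans by blast
    qed
  qed
  have nf0: "\<exists>c k i. i < p \<and> eqv t (N c k i)" if "t \<in> mons_R p" for t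
    using that
  proof (induction "\<Sum>i\<in>Poly_Mapping.keys t. Poly_Mapping.lookup t i" arbitrary: t rule: less_induct)
    case less
    show ?case
    proof (cases "t = 0")
      case True
      then have "t = N 0 0 0" by (simp add: N_def)
      then show ?thesis using assms(1) eqv_refl by (metis less_le_trans pos2)
    next
      case False
      then obtain j where j: "j \<in> Poly_Mapping.keys t" by fastforce
      define s where "s = t - ?x j"
      have ts: "t = s + ?x j"
      proof (rule poly_mapping_eqI)
        fix k show "Poly_Mapping.lookup t k = Poly_Mapping.lookup (s + ?x j) k"
          using j by (cases "k = j") (auto simp: s_def lookup_add lookup_minus lookup_single in_keys_iff)
      qed
      have ks: "Poly_Mapping.keys s \<subseteq> Poly_Mapping.keys t"
        by (auto simp: ts lookup_add in_keys_iff)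
      have sR: "s \<in> mons_R p" and jp: "j \<le> p" using ks less.prems j by (auto simp: mons_R_def)
      have "(\<Sum>i\<in>Poly_Mapping.keys s. Poly_Mapping.lookup s i)
          = (\<Sum>i\<in>Poly_Mapping.keys t. Poly_Mapping.lookup s i)"
        using ks by (intro sum.mono_neutral_left) (auto simp: in_keys_iff)
      also have "\<dots> < (\<Sum>i\<in>Poly_Mapping.keys t. Poly_Mapping.lookup t i)"
        using j by (intro sum_strict_mono2[of _ _ j] sum_strict_mono_ex1)
          (auto simp: ts lookup_add intro!: bexI[of _ j])
      finally obtain c k i where *: "i < p" "eqv s (N c k i)"
        using less.hyps sR by blast
      then have "eqv t (N c k i + ?x j)"
        using eqv_add[of s "N c k i" "?x j"] mons_R_single[OF jp] by (simp add: ts add.commute)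
      then show ?thesis using addvar[OF *(1) jp, of k c] eqv_trans by blast
    qed
  qed
  have nf: "\<exists>c k i. i < p \<and> k * p + i < m 0 \<and> eqv t (N c k i)" if t: "t \<in> mons_R p" for t
  proof -
    obtain c k i where *: "i < p" "eqv t (N c k i)"
      using nf0[OF t] by blast
    obtain c' k' i' where "i' < p" "k' * p + i' < m 0" "eqv (N c k i) (N c' k' i')"
      using red[OF *(1), of c k] by blast
    with eqv_trans[OF *(2)] show ?thesis by blast
  qed

  have wN: "wt m (N c k i) = (c + k + (if i = 0 then 0 else 1)) * m 0 + (k * p + i) * d"
    if "i < p" for c k i
    using that wm[of p] wm[of i] by (auto simp: N_def wt_add wt_single algebra_simps)
      (auto simp: wt_def)
  have Ninj: "N c k i = N c' k' i'"
    if "i < p" "i' < p" "k * p + i < m 0" "k' * p + i' < m 0"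
      "wt m (N c k i) = wt m (N c' k' i')" for c k i c' k' i'
  proof -
    have "[(k * p + i) * d = (k' * p + i') * d] (mod m 0)"
      using that(5) unfolding wN[OF that(1)] wN[OF that(2)] cong_def
      by (metis mod_mult_self3)
    then have "[k * p + i = k' * p + i'] (mod m 0)"
      using cop by (metis cong_mult_rcancel_nat coprime_commute coprime_iff_gcd_eq_1)
    then have e: "k * p + i = k' * p + i'"
      using that by (simp add: cong_def)
    have "k = (k * p + i) div p" "i = (k * p + i) mod p"
      "k' = (k' * p + i') div p" "i' = (k' * p + i') mod p" using that by auto
    with e have ki: "k = k'" "i = i'" by metis+
    with that(5) have "c = c'"
      unfolding wN[OF that(1)] wN[OF that(2)] using assms(3) by auto
    with ki show ?thesis by simp
  qed
  have wteq: "wt m s = wt m t" if "eqv s t" for s t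
  proof -
    have "?X s - ?X t \<in> wp p m"
      using that \<open>is_ideal p hull ?S \<subseteq> wp p m\<close> by (auto simp: eqv_def I_def)
    then have "eta m (?X s - ?X t) = 0" by (simp add: wp_def)
    moreover have "eta m (?X s) = eta m (?X s - ?X t) + eta m (?X t)"
      by (simp flip: eta_add)
    ultimately have "monom (1::'k) (wt m s) = monom 1 (wt m t)" by (simp add: eta_single)
    then show ?thesis by (metis coeff_monom zero_neq_one)
  qed
  have same: "eqv s t" if st: "s \<in> mons_R p" "t \<in> mons_R p" "wt m s = wt m t" for s t
  proof -
    obtain c k i where 1: "i < p" "k * p + i < m 0" "eqv s (N c k i)"
      using nf[OF st(1)] by blast
    obtain c' k' i' where 2: "i' < p" "k' * p + i' < m 0" "eqv t (N c' k' i')"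
      using nf[OF st(2)] by blast
    have "wt m (N c k i) = wt m (N c' k' i')" using wteq[OF 1(3)] wteq[OF 2(3)] st(3) by simp
    then have "N c k i = N c' k' i'" using Ninj 1 2 by blast
    with 1(3) eqv_sym[OF 2(3)] eqv_trans show ?thesis by metis
  qed

  show "wp p m \<subseteq> is_ideal p hull ?S"
  proof
    fix f :: "'k mpoly" assume f: "f \<in> wp p m"
    let ?K = "Poly_Mapping.keys f"
    define g where "g n = (SOME t. t \<in> ?K \<and> wt m t = n)" for n
    have g: "g (wt m t) \<in> ?K \<and> wt m (g (wt m t)) = wt m t" if "t \<in> ?K" for t
      unfolding g_def using someI[of "\<lambda>s. s \<in> ?K \<and> wt m s = wt m t" t] that by auto
    have KR: "?K \<subseteq> mons_R p" using f by (auto simp: wp_def ring_R_def)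
    let ?s = "\<lambda>t c. Poly_Mapping.single t c :: 'k mpoly"
    let ?l = "Poly_Mapping.lookup f"
    have "(\<Sum>t\<in>?K. ?s (g (wt m t)) (?l t)) = (\<Sum>n\<in>wt m ` ?K. \<Sum>t\<in>{t\<in>?K. wt m t = n}. ?s (g (wt m t)) (?l t))"
      by (simp add: sum.image_gen[of ?K _ "wt m"])
    also have "\<dots> = (\<Sum>n\<in>wt m ` ?K. ?s (g n) (\<Sum>t\<in>{t\<in>?K. wt m t = n}. ?l t))"
    proof (rule sum.cong[OF refl])
      fix n
      have "(\<Sum>t\<in>A. ?s u (?l t)) = ?s u (\<Sum>t\<in>A. ?l t)" for A u
        by (induction A rule: infinite_finite_induct) (auto simp: single_add)
      then show "(\<Sum>t\<in>{t\<in>?K. wt m t = n}. ?s (g (wt m t)) (?l t))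
          = ?s (g n) (\<Sum>t\<in>{t\<in>?K. wt m t = n}. ?l t)" by simp
    qed
    also have "\<dots> = 0"
    proof (rule sum.neutral, rule ballI)
      fix n
      have "0 = coeff (eta m f) n" using f by (simp add: wp_def)
      also have "\<dots> = (\<Sum>t\<in>?K. if wt m t = n then ?l t else 0)"
        by (simp add: eta_superset[of ?K] coeff_sum)
      also have "\<dots> = (\<Sum>t\<in>{t\<in>?K. wt m t = n}. ?l t)"
        by (simp add: sum.inter_filter)
      finally show "?s (g n) (\<Sum>t\<in>{t\<in>?K. wt m t = n}. ?l t) = 0" by simp
    qed
    finally have z: "(\<Sum>t\<in>?K. ?s (g (wt m t)) (?l t)) = 0" .
    have "f = (\<Sum>t\<in>?K. ?s t (?l t)) - (\<Sum>t\<in>?K. ?s (g (wt m t)) (?l t))"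
      using mpoly_expand[of f] z by simp
    also have "\<dots> = (\<Sum>t\<in>?K. ?s 0 (?l t) * (?X t - ?X (g (wt m t))))"
      by (simp add: sum_subtractf right_diff_distrib mult_single)
    also have "\<dots> \<in> I"
    proof (intro Isum Imul ring_R_single zeroR)
      fix t assume "t \<in> ?K"
      then show "?X t - ?X (g (wt m t)) \<in> I"
        using same[of t "g (wt m t)"] g[of t] KR by (auto simp: eqv_def)
    qed
    finally show "f \<in> is_ideal p hull ?S" by (simp add: I_def)
  qed
qed

end

theory Submission
  imports Defs
begin

text \<open>
  The order on the free module is a Schreyer order: \<open>varpi\<close> sends a module monomial to the
  leading monomial of its image in \<open>R\<close>.  Hence the leading monomial \<open>(t, e)\<close> of a nonzero
  syzygy must share its \<open>varpi\<close> with another monomial \<open>(t', e')\<close> of the support, with \<open>e'\<close>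
  smaller than \<open>e\<close>; otherwise its image could not cancel.  Comparing
  \<open>t + varpi (0, e) = t' + varpi (0, e')\<close> for all pairs of symbols shows that \<open>(t, e)\<close> is
  divisible by the leading monomial of some \<open>A\<close>, \<open>B\<close> or \<open>L\<close>.
\<close>

subsection \<open>The monomial orders\<close>

lemma gr_R_asym: "gr_R p m f g \<Longrightarrow> \<not> gr_R p m g f"
proof
  assume fg: "gr_R p m f g" and gf: "gr_R p m g f"
  then have w: "wt m f = wt m g" unfolding gr_R_def by linarith
  obtain k where "k \<le> p" and k: "Poly_Mapping.lookup f k < Poly_Mapping.lookup g k"
    "\<forall>i\<in>right_of p k. Poly_Mapping.lookup f i = Poly_Mapping.lookup g i"
    using fg w unfolding gr_R_def by auto
  obtain l where "l \<le> p" and l: "Poly_Mapping.lookup g l < Poly_Mapping.lookup f l"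
    "\<forall>i\<in>right_of p l. Poly_Mapping.lookup g i = Poly_Mapping.lookup f i"
    using gf w unfolding gr_R_def by auto
  \<comment> \<open>The positions from the right form a chain. Whichever deciding position lies
    further right, the other comparison demands equality there.\<close>
  have "k = l \<or> k \<in> right_of p l \<or> l \<in> right_of p k"
    using \<open>k \<le> p\<close> \<open>l \<le> p\<close> by (auto simp: right_of_def)
  then show False
  proof (elim disjE)
    assume "k = l"
    then show False using k(1) l(1) by simp
  next
    assume "k \<in> right_of p l"
    with l(2) have "Poly_Mapping.lookup g k = Poly_Mapping.lookup f k" by (rule bspec)
    with k(1) show False by simp
  next
    assume "l \<in> right_of p k"
    with k(2) have "Poly_Mapping.lookup f l = Poly_Mapping.lookup g l" by (rule bspec)
    with l(1) show False by simp
  qed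
qed

lemma gr_R_trans:
  assumes "gr_R p m f g" "gr_R p m g h"
  shows "gr_R p m f h"
proof (cases "wt m f = wt m g \<and> wt m g = wt m h")
  case True
  then obtain k l where "k \<le> p" "l \<le> p"
    and k: "Poly_Mapping.lookup f k < Poly_Mapping.lookup g k"
    "\<forall>i\<in>right_of p k. Poly_Mapping.lookup f i = Poly_Mapping.lookup g i"
    and l: "Poly_Mapping.lookup g l < Poly_Mapping.lookup h l"
    "\<forall>i\<in>right_of p l. Poly_Mapping.lookup g i = Poly_Mapping.lookup h i"
    using assms unfolding gr_R_def by auto
  \<comment> \<open>The comparison of \<open>f\<close> with \<open>h\<close> is decided at the
    further right of the two positions. Everything to its right is also to the right of the other
    position, so all three exponents agree there.\<close>
  consider "k = l" | "k \<in> right_of p l" "right_of p k \<subseteq> right_of p l"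
    | "l \<in> right_of p k" "right_of p l \<subseteq> right_of p k"
  proof -
    have "k = l \<or> k \<in> right_of p l \<and> right_of p k \<subseteq> right_of p l \<or>
        l \<in> right_of p k \<and> right_of p l \<subseteq> right_of p k"
      using \<open>k \<le> p\<close> \<open>l \<le> p\<close> by (auto simp: right_of_def)
    then show ?thesis using that by blast
  qed
  then have "\<exists>j\<le>p. Poly_Mapping.lookup f j < Poly_Mapping.lookup h j \<and>
      (\<forall>i\<in>right_of p j. Poly_Mapping.lookup f i = Poly_Mapping.lookup h i)"
  proof cases
    case 1
    then show ?thesis using k l \<open>k \<le> p\<close> by (intro exI[of _ k]) auto
  next
    case 2
    then show ?thesis using k l \<open>k \<le> p\<close> by (intro exI[of _ k]) auto
  next
    case 3
    then show ?thesis using k l \<open>l \<le> p\<close> by (intro exI[of _ l]) auto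
  qed
  then show ?thesis using True unfolding gr_R_def by auto
next
  case False
  then show ?thesis using assms unfolding gr_R_def by auto
qed

lemma gr_R_total:
  assumes "s \<in> mons_R p" "t \<in> mons_R p" "s \<noteq> t"
  shows "gr_R p m s t \<or> gr_R p m t s"
proof -
  let ?l = Poly_Mapping.lookup
  let ?D = "{i. ?l s i \<noteq> ?l t i}"
  have D: "?D \<subseteq> {0..p}"
  proof
    fix i assume "i \<in> ?D"
    then have "i \<in> Poly_Mapping.keys s \<or> i \<in> Poly_Mapping.keys t" by (auto simp: in_keys_iff)
    then show "i \<in> {0..p}" using assms(1,2) by (auto simp: mons_R_def)
  qed
  then have fin: "finite ?D" by (rule finite_subset) simp
  have ne: "?D \<noteq> {}" using assms(3) by (auto intro: poly_mapping_eqI)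
  \<comment> \<open>This is the right-most differing position. Exponents are read as 1, ..., p, 0,
    so a difference at 0 takes precedence over the maximal differing index.\<close>
  define k where "k = (if 0 \<in> ?D then 0 else Max ?D)"
  have kD: "k \<in> ?D" using Max_in[OF fin ne] by (auto simp: k_def)
  have "i \<notin> ?D" if "i \<in> right_of p k" for i
  proof
    assume "i \<in> ?D"
    then have "i \<le> Max ?D" using Max_ge[OF fin] by blast
    moreover have "k = Max ?D \<and> 0 \<notin> ?D \<or> k = 0" by (simp add: k_def)
    ultimately show False using that \<open>i \<in> ?D\<close> unfolding right_of_def by (auto split: if_splits)
  qed
  then have "\<forall>i\<in>right_of p k. ?l s i = ?l t i" by auto
  moreover have "k \<le> p" "?l s k \<noteq> ?l t k" using kD D by auto
  ultimately have "\<exists>j\<le>p. ?l s j < ?l t j \<and> (\<forall>i\<in>right_of p j. ?l s i = ?l t i) \<or>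
      ?l t j < ?l s j \<and> (\<forall>i\<in>right_of p j. ?l t i = ?l s i)"
    by (intro exI[of _ k]) (simp add: neq_iff)
  then show ?thesis unfolding gr_R_def by (cases "wt m s" "wt m t" rule: linorder_cases) auto
qed

lemma gr_R_add_left: "gr_R p m (r + f) (r + g) \<longleftrightarrow> gr_R p m f g"
  by (simp add: gr_R_def wt_add lookup_add)

lemma gr_symb_asym: "gr_symb e e' \<Longrightarrow> \<not> gr_symb e' e"
  by (cases e; cases e') auto

lemma gr_symb_trans: "gr_symb e e' \<Longrightarrow> gr_symb e' e'' \<Longrightarrow> gr_symb e e''"
  by (cases e; cases e'; cases e'') auto

lemma gr_symb_total: "e \<noteq> e' \<Longrightarrow> gr_symb e e' \<or> gr_symb e' e"
  by (cases e; cases e') auto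

lemma varpi_add: "varpi p a b (s + t, e) = s + varpi p a b (t, e)"
  by (cases e) (simp_all add: ac_simps)

lemma varpi_split: "varpi p a b (t, e) = t + varpi p a b (0, e)"
  using varpi_add[of p a b t 0 e] by simp

lemma gr_M_asym: "gr_M p a b m u u' \<Longrightarrow> \<not> gr_M p a b m u' u"
  unfolding gr_M_def using gr_R_asym gr_symb_asym by metis

lemma gr_M_trans: "gr_M p a b m u u' \<Longrightarrow> gr_M p a b m u' u'' \<Longrightarrow> gr_M p a b m u u''"
  unfolding gr_M_def
  by (elim disjE conjE) (simp_all, blast dest: gr_R_trans, blast dest: gr_symb_trans)

lemma gr_M_total:
  assumes "varpi p a b u \<in> mons_R p" "varpi p a b u' \<in> mons_R p" "u \<noteq> u'"
  shows "gr_M p a b m u u' \<or> gr_M p a b m u' u"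
proof (cases "varpi p a b u = varpi p a b u'")
  case True
  \<comment> \<open>With equal symbols, the common factor \<open>varpi p a b (0, snd u)\<close>
    cancels from the equal \<open>varpi\<close> values, so the two monomials would coincide.\<close>
  have "snd u \<noteq> snd u'"
  proof
    assume e: "snd u = snd u'"
    then have "fst u + varpi p a b (0, snd u) = fst u' + varpi p a b (0, snd u)"
      using True varpi_split[of p a b "fst u"] varpi_split[of p a b "fst u'"] by (metis prod.collapse)
    then show False using assms(3) e by (simp add: prod_eq_iff)
  qed
  then have "gr_symb (snd u) (snd u') \<or> gr_symb (snd u') (snd u)" by (rule gr_symb_total)
  then show ?thesis using True unfolding gr_M_def by auto
next
  case False
  from gr_R_total[OF assms(1,2) this, of m] show ?thesis unfolding gr_M_def by blast
qed

text \<open>Supplies leading monomials. Totality is assumed on \<open>A\<close> only, because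
  \<open>gr_M_total\<close> covers only monomials whose \<open>varpi\<close> involves no variable
  beyond \<open>X_p\<close>.\<close>

lemma finite_strict_maximum:
  assumes "finite A" "A \<noteq> {}"
    and "\<And>x y z. R x y \<Longrightarrow> R y z \<Longrightarrow> R x z"
    and "\<And>x y. x \<in> A \<Longrightarrow> y \<in> A \<Longrightarrow> x \<noteq> y \<Longrightarrow> R x y \<or> R y x"
  shows "\<exists>x\<in>A. \<forall>y\<in>A. y \<noteq> x \<longrightarrow> R x y"
  using assms(1,2,4)
proof (induction A rule: finite_ne_induct)
  case (insert x F)
  have "\<exists>z\<in>F. \<forall>y\<in>F. y \<noteq> z \<longrightarrow> R z y"
    by (rule insert.IH) (rule insert.prems, simp_all)
  then obtain z where z: "z \<in> F" "\<forall>y\<in>F. y \<noteq> z \<longrightarrow> R z y" by blast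
  then have "z \<noteq> x" using insert.hyps by auto
  then have "R x z \<or> R z x" using z(1) by (intro insert.prems) simp_all
  then consider "R x z" | "R z x" by blast
  then show ?case
  proof cases
    case 1
    have "R x y" if "y \<in> F" for y
      using that z(2) assms(3)[OF 1, of y] 1 by (cases "y = z") simp_all
    then show ?thesis by (intro bexI[of _ x]) auto
  next
    case 2
    then show ?thesis using z by (intro bexI[of _ z]) auto
  qed
qed simp


subsection \<open>Leading terms\<close>

lemma finite_supp_M: "finite (supp_M v)"
proof (rule finite_subset)
  show "supp_M v \<subseteq> (\<Union>e\<in>Poly_Mapping.keys v. Poly_Mapping.keys (Poly_Mapping.lookup v e) \<times> {e})"
    by (auto simp: supp_M_def in_keys_iff)
qed auto

lemma supp_M_nonempty: "v \<noteq> 0 \<Longrightarrow> supp_M v \<noteq> {}"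
  by (auto simp: supp_M_def) (metis lookup_zero poly_mapping_eqI)

lemma lead_mon_eqI:
  assumes "u \<in> supp_M v" "\<And>u'. u' \<in> supp_M v \<Longrightarrow> u' \<noteq> u \<Longrightarrow> gr_M p a b m u u'"
  shows "lead_mon p a b m v = u"
  unfolding lead_mon_def
proof (rule the_equality)
  fix u' assume "u' \<in> supp_M v \<and> (\<forall>u''\<in>supp_M v. u'' \<noteq> u' \<longrightarrow> gr_M p a b m u' u'')"
  then show "u' = u" using assms gr_M_asym by metis
qed (use assms in auto)

text \<open>This bound on a remainder is preserved by sums and differences. The leading terms of the
  explicit syzygies can thus be checked summand by summand, even if summands cancel or
  coincide.\<close>

definition below :: "(mon \<times> symb \<Rightarrow> mon \<times> symb \<Rightarrow> bool) \<Rightarrow> mon \<times> symb \<Rightarrow> 'k::field vec \<Rightarrow> bool" where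
  "below R u v \<longleftrightarrow> (\<forall>u'\<in>supp_M v. R u u')"

lemma below_zero: "below R u 0"
  by (simp add: below_def supp_M_def)

lemma below_add: "below R u v \<Longrightarrow> below R u w \<Longrightarrow> below R u (v + w)"
  by (auto simp: below_def supp_M_def lookup_add) (metis add_cancel_right_right)

lemma below_diff: "below R u v \<Longrightarrow> below R u w \<Longrightarrow> below R u (v - w)"
  by (auto simp: below_def supp_M_def lookup_minus) (metis diff_zero)

lemma below_single: "R u (t, e) \<Longrightarrow> below R u (Poly_Mapping.single e (Poly_Mapping.single t c))"
  by (auto simp: below_def supp_M_def lookup_single when_def split: if_splits)

text \<open>Asymmetry of \<open>gr_M\<close> makes it irreflexive, so \<open>(t, e)\<close> does not
  occur in \<open>h\<close>. Its coefficient in the sum is therefore exactly 1, and every other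
  monomial comes from \<open>h\<close>.\<close>

lemma lead_term_single_add:
  fixes h :: "'k::field vec"
  assumes "below (gr_M p a b m) (t, e) h"
  shows "lead_term p a b m (Poly_Mapping.single e (Poly_Mapping.single t 1) + h)
    = Poly_Mapping.single e (Poly_Mapping.single t 1)" (is "lead_term p a b m ?v = ?u")
proof -
  have "(t, e) \<notin> supp_M h" using assms gr_M_asym unfolding below_def by blast
  then have c: "Poly_Mapping.lookup (Poly_Mapping.lookup ?v e) t = 1"
    by (simp add: supp_M_def lookup_add)
  have "lead_mon p a b m ?v = (t, e)"
  proof (rule lead_mon_eqI)
    fix u' assume "u' \<in> supp_M ?v" "u' \<noteq> (t, e)"
    then have "u' \<in> supp_M h"
      by (auto simp: supp_M_def lookup_add lookup_single when_def split: if_splits)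
    then show "gr_M p a b m (t, e) u'" using assms unfolding below_def by blast
  qed (simp add: supp_M_def c)
  moreover have "?v \<noteq> 0" using c by auto
  ultimately show ?thesis by (simp add: lead_term_def c)
qed

section \<open>Scalar multiplication on the free module\<close>

lemma lookup_scale: "Poly_Mapping.lookup (f *m v) e = f * Poly_Mapping.lookup v e"
  by (simp add: scale_def Poly_Mapping.map.rep_eq when_def)

lemma scale_single: "f *m Poly_Mapping.single e g = Poly_Mapping.single e (f * g)"
  by (rule poly_mapping_eqI) (simp add: lookup_scale lookup_single when_def)

lemma scale_zero: "f *m 0 = 0"
  by (rule poly_mapping_eqI) (simp add: lookup_scale)

lemma scale_diff_right: "f *m (v - w) = f *m v - f *m w"
  by (rule poly_mapping_eqI) (simp add: lookup_scale lookup_minus right_diff_distrib)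

lemma scale_diff_left: "(f - g) *m v = f *m v - g *m v"
  by (rule poly_mapping_eqI) (simp add: lookup_scale lookup_minus left_diff_distrib)

lemma below_scale_PsiV:
  "R u (t, Psi i) \<Longrightarrow> below R u (Poly_Mapping.single t 1 *m PsiV i)"
  by (simp add: PsiV_def scale_single mult_single below_single)

text \<open>The comparison is demanded only for indices in range, since otherwise
  \<open>PhiV\<close> is zero and has no monomials to compare.\<close>

lemma below_scale_PhiV:
  assumes "i \<in> {1..p-1} \<Longrightarrow> j \<in> {1..p-1} \<Longrightarrow> R u (t, Phi (min i j) (max i j))"
  shows "below R u (Poly_Mapping.single t 1 *m PhiV p i j)"
  using assms by (auto simp: PhiV_def scale_single mult_single scale_zero below_zero intro!: below_single)


subsection \<open>The syzygy module\<close>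

lemma gen_map_superset:
  "finite A \<Longrightarrow> Poly_Mapping.keys v \<subseteq> A \<Longrightarrow>
   gen_map p d a b v = (\<Sum>e\<in>A. Poly_Mapping.lookup v e * gen_val p d a b e)"
  unfolding gen_map_def by (rule sum.mono_neutral_left) (auto simp: in_keys_iff)

lemma gen_map_add: "gen_map p d a b (v + w) = gen_map p d a b v + gen_map p d a b w"
proof -
  let ?A = "Poly_Mapping.keys v \<union> Poly_Mapping.keys w"
  have "Poly_Mapping.keys (v + w) \<subseteq> ?A" by (rule Poly_Mapping.keys_add)
  then show ?thesis
    by (simp add: gen_map_superset[of ?A] lookup_add distrib_right sum.distrib)
qed

lemma gen_map_diff: "gen_map p d a b (v - w) = gen_map p d a b v - gen_map p d a b w"
  using gen_map_add[of p d a b "v - w" w] by simp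

lemma gen_map_scale: "gen_map p d a b (f *m v) = f * gen_map p d a b v"
proof -
  have "Poly_Mapping.keys (f *m v) \<subseteq> Poly_Mapping.keys v"
    by (auto simp: in_keys_iff lookup_scale)
  then show ?thesis
    by (simp add: gen_map_superset[of "Poly_Mapping.keys v"] lookup_scale sum_distrib_left mult.assoc)
qed

lemma gen_map_PsiV: "gen_map p d a b (PsiV i) = psi p d a b i"
  by (simp add: PsiV_def gen_map_def)

lemma phi_commute: "phi p i j = phi p j i"
  by (simp add: phi_def eps_def ac_simps)

lemma gen_map_PhiV:
  "gen_map p d a b (PhiV p i j) = (if i \<in> {1..p-1} \<and> j \<in> {1..p-1} then phi p i j else 0)"
  by (auto simp: PhiV_def gen_map_def min_def max_def phi_commute[of p i j])

lemma free_module_add: "v \<in> free_module p b \<Longrightarrow> w \<in> free_module p b \<Longrightarrow> v + w \<in> free_module p b"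
  using Poly_Mapping.keys_add[of v w] by (auto simp: free_module_def lookup_add ring_R_add)

lemma free_module_diff: "v \<in> free_module p b \<Longrightarrow> w \<in> free_module p b \<Longrightarrow> v - w \<in> free_module p b"
  using Poly_Mapping.keys_diff[of v w] by (auto simp: free_module_def lookup_minus ring_R_diff)

lemma free_module_scale: "f \<in> ring_R p \<Longrightarrow> v \<in> free_module p b \<Longrightarrow> f *m v \<in> free_module p b"
  by (auto simp: free_module_def lookup_scale ring_R_mult in_keys_iff subset_iff)

lemma ring_R_one: "1 \<in> ring_R p"
  unfolding single_one[symmetric] by (rule ring_R_single) (simp add: mons_R_def)

lemma ring_R_var_power: "i \<le> p \<Longrightarrow> var i ^ n \<in> ring_R p"
  by (simp add: var_power ring_R_single mons_R_single)

lemma ring_R_var: "i \<le> p \<Longrightarrow> var i \<in> ring_R p"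
  using ring_R_var_power[of i p 1] by simp

lemma free_module_PsiV: "i \<le> p - b \<Longrightarrow> PsiV i \<in> free_module p b"
  by (auto simp: free_module_def PsiV_def symbs_def lookup_single when_def ring_R_one ring_R_zero)

lemma free_module_PhiV: "PhiV p i j \<in> free_module p b"
  by (auto simp: free_module_def PhiV_def symbs_def lookup_single when_def ring_R_one ring_R_zero
      min_def max_def)

lemmas free_module_intros = free_module_add free_module_diff free_module_scale free_module_PsiV
  free_module_PhiV ring_R_var ring_R_var_power ring_R_mult ring_R_diff

text \<open>One summand per module monomial, so that the coefficient of a fixed power product in the
  image can be computed term by term.\<close>

lemma gen_map_monomials:
  fixes v :: "'k::field vec"
  shows "gen_map p d a b v = (\<Sum>(t, e)\<in>supp_M v.
    Poly_Mapping.single t (Poly_Mapping.lookup (Poly_Mapping.lookup v e) t) * gen_val p d a b e)"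
proof -
  let ?K = "Poly_Mapping.keys v"
  let ?T = "\<lambda>e. Poly_Mapping.keys (Poly_Mapping.lookup v e)"
  let ?s = "\<lambda>t e. Poly_Mapping.single t (Poly_Mapping.lookup (Poly_Mapping.lookup v e) t)"
  have S: "prod.swap ` supp_M v = Sigma ?K ?T"
    by (force simp: supp_M_def in_keys_iff)
  have "gen_map p d a b v = (\<Sum>e\<in>?K. \<Sum>t\<in>?T e. ?s t e * gen_val p d a b e)"
    unfolding gen_map_def sum_distrib_right[symmetric] by (simp flip: mpoly_expand)
  also have "\<dots> = (\<Sum>(e, t)\<in>Sigma ?K ?T. ?s t e * gen_val p d a b e)"
    by (rule sum.Sigma) auto
  also have "\<dots> = (\<Sum>(t, e)\<in>supp_M v. ?s t e * gen_val p d a b e)"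
    unfolding S[symmetric] by (subst sum.reindex) (auto simp: split_def)
  finally show ?thesis .
qed

text \<open>Each generator is a difference of two power products. This is the subtracted one; the
  other is \<open>varpi p a b (0, e)\<close>.\<close>

fun tail_mon :: "nat \<Rightarrow> nat \<Rightarrow> nat \<Rightarrow> symb \<Rightarrow> mon" where
  "tail_mon p d a (Psi i) = Poly_Mapping.single i 1 + Poly_Mapping.single 0 (a + d)"
| "tail_mon p d a (Phi i j)
    = Poly_Mapping.single (eps p i j) 1 + Poly_Mapping.single (i + j - eps p i j) 1"

lemma gen_val_binomial:
  "gen_val p d a b e
    = Poly_Mapping.single (varpi p a b (0, e)) 1 - Poly_Mapping.single (tail_mon p d a e) 1"
  by (cases e; simp add: psi_def phi_def var_power) (simp_all add: var_def mult_single ac_simps)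

lemma mons_R_add_iff: "s + t \<in> mons_R p \<longleftrightarrow> s \<in> mons_R p \<and> t \<in> mons_R p"
proof -
  have "Poly_Mapping.keys (s + t) = Poly_Mapping.keys s \<union> Poly_Mapping.keys t"
    by (auto simp: in_keys_iff lookup_add)
  then show ?thesis by (simp add: mons_R_def)
qed

lemma supp_M_free_module:
  assumes "v \<in> free_module p b" "(t, e) \<in> supp_M v"
  shows "t \<in> mons_R p" "e \<in> symbs p b"
proof -
  have "Poly_Mapping.lookup v e \<in> ring_R p" "Poly_Mapping.keys v \<subseteq> symbs p b"
    using assms(1) by (auto simp: free_module_def)
  moreover have "t \<in> Poly_Mapping.keys (Poly_Mapping.lookup v e)" "e \<in> Poly_Mapping.keys v"
    using assms(2) by (auto simp: supp_M_def in_keys_iff)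
  ultimately show "t \<in> mons_R p" "e \<in> symbs p b"
    by (auto simp: ring_R_def)
qed

text \<open>At a variable of \<open>r\<close> the factor \<open>s\<close> has exponent 0, so
  \<open>t\<close> alone must supply the exponent of \<open>r\<close>. This extracts divisors of a
  leading monomial from an equality of \<open>varpi\<close> values.\<close>

lemma divides_of_disjoint:
  fixes t s t' r :: mon
  assumes "t + s = t' + r" "Poly_Mapping.keys s \<inter> Poly_Mapping.keys r = {}"
  shows "\<exists>q. t = q + r"
proof
  show "t = (t - r) + r"
  proof (rule poly_mapping_eqI)
    fix k
    have "Poly_Mapping.lookup (t + s) k = Poly_Mapping.lookup (t' + r) k" using assms(1) by simp
    moreover have "Poly_Mapping.lookup s k = 0 \<or> Poly_Mapping.lookup r k = 0"
      using assms(2) by (auto simp: in_keys_iff)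
    ultimately show "Poly_Mapping.lookup t k = Poly_Mapping.lookup (t - r + r) k"
      by (auto simp: lookup_add lookup_minus)
  qed
qed


subsection \<open>The generators of the ideal and their syzygies\<close>

abbreviation x_mon :: "nat \<Rightarrow> mon" where
  "x_mon i \<equiv> Poly_Mapping.single i 1"

lemma x_mon_min_max: "x_mon (min i j) + x_mon (max i j) = x_mon i + x_mon j"
  by (simp add: min_def max_def add.commute)

lemma var_eq: "var i = Poly_Mapping.single (x_mon i) 1"
  by (simp add: var_def)

text \<open>For \<open>i + j < p\<close> both forms subtract \<open>X_0 * X_(i+j)\<close>, with the
  factors exchanged; otherwise \<open>tau\<close> and \<open>eps\<close> agree.\<close>

lemma phi_eq: "phi p i j = var i * var j - var (tau p i j) * var (i + j - tau p i j)"
  by (simp add: phi_def eps_def tau_def)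

text \<open>If an index is 0 or p, both products in \<open>phi\<close> are the same. The convention
  that \<open>PhiV\<close> vanishes out of range is thus compatible with \<open>gen_map\<close> on
  all of [0,p], which spares boundary cases later.\<close>

lemma phi_boundary: "i \<le> p \<Longrightarrow> j \<le> p \<Longrightarrow> \<not> (i \<in> {1..p-1} \<and> j \<in> {1..p-1}) \<Longrightarrow> phi p i j = 0"
proof -
  assume "i \<le> p" "j \<le> p" "\<not> (i \<in> {1..p-1} \<and> j \<in> {1..p-1})"
  then consider "i = 0" "j < p" | "i = 0" "j = p" | "i = p" | "j = 0" "i < p" | "j = p"
    by force
  then show ?thesis by cases (auto simp: phi_def eps_def mult.commute)
qed

lemma gen_map_PhiV_le: "i \<le> p \<Longrightarrow> j \<le> p \<Longrightarrow> gen_map p d a b (PhiV p i j) = phi p i j"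
  using phi_boundary[of i p j] by (auto simp: gen_map_PhiV)

section \<open>Leading monomials of the generators and cancellation in a syzygy\<close>

locale arithmetic_semigroup =
  fixes p d a b :: nat and m :: "nat \<Rightarrow> nat"
  assumes m_eq: "\<forall>i\<in>{1..p}. m i = m 0 + i * d"
    and m0: "m 0 = a * p + b"
    and a: "a \<ge> 1"
    and b: "b \<in> {1..p}"
begin

lemma m_le: "i \<le> p \<Longrightarrow> m i = m 0 + i * d"
  using m_eq by (cases "i = 0") auto

lemma gr_phi:
  assumes "i \<in> {1..p-1}" "j \<in> {1..p-1}"
  shows "gr_R p m (x_mon i + x_mon j) (x_mon (tau p i j) + x_mon (i + j - tau p i j))"
proof -
  let ?k = "tau p i j" and ?l = "i + j - tau p i j"
  have le: "i \<le> p" "j \<le> p" "?k \<le> p" "?l \<le> p" and s: "i + j = ?k + ?l"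
    using assms by (auto simp: tau_def)
  have "i * d + j * d = ?k * d + ?l * d" using s by (metis distrib_right)
  then have w: "m i + m j = m ?k + m ?l"
    unfolding m_le[OF le(1)] m_le[OF le(2)] m_le[OF le(3)] m_le[OF le(4)] by linarith
  \<comment> \<open>The weights agree because the index sums do, so the tie is broken at the
    right-most variable of the tail: \<open>X_0\<close> if \<open>i + j \<le> p\<close> (for
    \<open>i + j = p\<close> the tail is \<open>X_p * X_0\<close>), and \<open>X_p\<close>
    otherwise. Neither occurs in \<open>X_i * X_j\<close>.\<close>
  define q where "q = (if i + j \<le> p then 0 else p)"
  have "q \<le> p" by (simp add: q_def)
  moreover have "Poly_Mapping.lookup (x_mon i + x_mon j) q = 0"
    using assms by (auto simp: lookup_add lookup_single q_def when_def)
  moreover have "Poly_Mapping.lookup (x_mon ?k + x_mon ?l) q > 0"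
    using assms by (auto simp: lookup_add lookup_single q_def tau_def when_def)
  moreover have "Poly_Mapping.lookup (x_mon i + x_mon j) r = Poly_Mapping.lookup (x_mon ?k + x_mon ?l) r"
    if "r \<in> right_of p q" for r
    using that assms by (auto simp: lookup_add lookup_single q_def tau_def when_def right_of_def
        split: if_splits)
  ultimately show ?thesis
    unfolding gr_R_def by (auto simp: wt_add wt_single w intro!: exI[of _ q])
qed

lemma gr_psi:
  assumes "i \<le> p - b"
  shows "gr_R p m (x_mon (b + i) + Poly_Mapping.single p a) (x_mon i + Poly_Mapping.single 0 (a + d))"
proof -
  have le: "b + i \<le> p" "i \<le> p" using assms b by auto
  \<comment> \<open>The extra \<open>d\<close> factors of \<open>X_0\<close> in the tail of
    \<open>psi\<close> have weight \<open>d * m 0\<close>, which is exactly the surplus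
    \<open>(a * p + b) * d\<close> of the head. The tie is then broken by \<open>X_0\<close>, absent
    from the head.\<close>
  have "b * d + a * p * d = m 0 * d" by (simp add: m0 algebra_simps)
  then have w: "m (b + i) + a * m p = m i + (a + d) * m 0"
    unfolding m_le[OF le(1)] m_le[OF le(2)] m_le[OF order_refl] by (simp add: algebra_simps)
  have "p \<noteq> 0" using b by auto
  then have "Poly_Mapping.lookup (x_mon (b + i) + Poly_Mapping.single p a) 0 = 0"
    "Poly_Mapping.lookup (x_mon i + Poly_Mapping.single 0 (a + d)) 0 > 0"
    using a b by (auto simp: lookup_add lookup_single when_def)
  then show ?thesis
    unfolding gr_R_def by (auto simp: wt_add wt_single w right_of_def intro!: exI[of _ 0])
qed

lemma gr_tail_mon: "e \<in> symbs p b \<Longrightarrow> gr_R p m (varpi p a b (0, e)) (tail_mon p d a e)"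
proof -
  assume "e \<in> symbs p b"
  then consider i where "e = Psi i" "i \<le> p - b" | i j where "e = Phi i j" "i \<in> {1..p-1}" "j \<in> {1..p-1}"
    by (auto simp: symbs_def)
  then show ?thesis
  proof cases
    case 1
    then show ?thesis using gr_psi[of i] by (simp add: add.commute)
  next
    case 2
    then show ?thesis using gr_phi[of i j] by (auto simp: eps_def tau_def add.commute split: if_splits)
  qed
qed

text \<open>The coefficient of \<open>varpi p a b (t, e)\<close> in the image of \<open>v\<close> is
  computed. If no smaller symbol shared this power product, only \<open>(t, e)\<close> itself would
  contribute, and the coefficient would be nonzero.\<close>

lemma syzygy_lead_cancels:
  fixes v :: "'k::field vec"
  assumes v: "v \<in> syzygy_module p d a b"
    and u: "(t, e) \<in> supp_M v" "\<And>u'. u' \<in> supp_M v \<Longrightarrow> u' \<noteq> (t, e) \<Longrightarrow> gr_M p a b m (t, e) u'"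
  obtains t' e' where "e' \<in> symbs p b" "gr_symb e e'"
    "t + varpi p a b (0, e) = t' + varpi p a b (0, e')"
proof (rule ccontr)
  let ?w = "varpi p a b (t, e)"
  let ?c = "\<lambda>t e. Poly_Mapping.lookup (Poly_Mapping.lookup v e) t"
  let ?g = "\<lambda>e. gen_val p d a b e :: 'k mpoly"
  assume "\<not> thesis"
  with that have no: "False" if "e' \<in> symbs p b" "gr_symb e e'"
    "t + varpi p a b (0, e) = t' + varpi p a b (0, e')" for t' e'
    using that by blast
  have free: "v \<in> free_module p b" and "gen_map p d a b v = 0"
    using v by (auto simp: syzygy_module_def)
  then have "0 = Poly_Mapping.lookup (gen_map p d a b v) ?w" by simp
  also have "\<dots> = (\<Sum>(t', e')\<in>supp_M v. Poly_Mapping.lookup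
      (Poly_Mapping.single t' (?c t' e') * ?g e') ?w)"
    by (simp add: gen_map_monomials lookup_sum split_def)
  also have "\<dots> = (\<Sum>u'\<in>supp_M v. if u' = (t, e) then ?c t e else 0)"
  proof (rule sum.cong[OF refl], clarify)
    fix t' e' assume u': "(t', e') \<in> supp_M v"
    have 1: "Poly_Mapping.lookup (Poly_Mapping.single t' (?c t' e') * ?g e') ?w
      = (?c t' e' when varpi p a b (t', e') = ?w) - (?c t' e' when t' + tail_mon p d a e' = ?w)"
      unfolding gen_val_binomial varpi_split[of p a b t' e']
      by (simp add: right_diff_distrib mult_single lookup_minus lookup_single)
    have gt: "gr_R p m (varpi p a b (t', e')) (t' + tail_mon p d a e')"
      using gr_tail_mon[OF supp_M_free_module(2)[OF free u']]
      unfolding varpi_split[of p a b t' e'] gr_R_add_left .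
    \<comment> \<open>A tail is strictly below its own head, and no head exceeds \<open>?w\<close>
      by maximality of \<open>(t, e)\<close>; hence tails never reach \<open>?w\<close>.\<close>
    have 2: "t' + tail_mon p d a e' \<noteq> ?w"
    proof
      assume "t' + tail_mon p d a e' = ?w"
      with gt have "gr_R p m (varpi p a b (t', e')) ?w" by simp
      moreover from this have "(t', e') \<noteq> (t, e)" using gr_R_asym by blast
      ultimately show False using u(2)[OF u'] gr_R_asym[of p m]
        unfolding gr_M_def by metis
    qed
    \<comment> \<open>Another head equal to \<open>?w\<close> would have lost to
      \<open>(t, e)\<close> by the symbol order, which is the situation that \<open>no\<close>
      excludes.\<close>
    have 3: "varpi p a b (t', e') = ?w \<longleftrightarrow> (t', e') = (t, e)"
    proof
      assume w: "varpi p a b (t', e') = ?w"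
      show "(t', e') = (t, e)"
      proof (rule ccontr)
        assume "(t', e') \<noteq> (t, e)"
        then have "gr_symb e e'" using u(2)[OF u'] w gr_R_asym[of p m ?w ?w] by (auto simp: gr_M_def)
        then show False
          using no[OF supp_M_free_module(2)[OF free u'], of t'] w
            varpi_split[of p a b t e] varpi_split[of p a b t' e'] by metis
      qed
    qed simp
    show "Poly_Mapping.lookup (Poly_Mapping.single t' (?c t' e') * ?g e') ?w
      = (if (t', e') = (t, e) then ?c t e else 0)"
      unfolding 1 3 using 2 by (auto simp: when_def)
  qed
  also have "\<dots> = ?c t e" using u(1) by (simp add: finite_supp_M)
  finally show False using u(1) by (simp add: supp_M_def)
qed

section \<open>A, B and L are syzygies\<close>

lemma A_syz_in_syzygy_module:
  assumes i: "i \<in> {1..p}" and j: "j < p - b"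
  shows "A_syz p d a b i j \<in> syzygy_module p d a b"
proof -
  have le: "i \<le> p" "j \<le> p" "b + j \<le> p" "p - b \<le> p" "b + i + j - p \<le> p" "j \<le> p - b"
    "eps p i (b + j) - b \<le> p - b" "b + i + j - eps p i (b + j) \<le> p"
    using i j by (auto simp: eps_def)
  have "gen_map p d a b (A_syz p d a b i j :: 'a vec) = 0"
  proof (cases "i + (b + j) < p")
    case True
    \<comment> \<open>The truncated index 0 stands for a negative one; the corresponding
      \<open>phi\<close> is zero, as the convention for \<open>PhiV\<close> requires.\<close>
    have "b + i + j - p = 0" using True by simp
    moreover have "phi p 0 (p - b) = (0 :: 'a mpoly)" by (rule phi_boundary) auto
    ultimately show ?thesis
      unfolding A_syz_def using True j le
      by (simp add: gen_map_add gen_map_diff gen_map_scale gen_map_PsiV gen_map_PhiV_le)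
        (simp add: psi_def phi_eq tau_def eps_def algebra_simps)
  next
    case False
    have e: "eps p i (b + j) = p" and k: "b + i + j - p + (p - b) = i + j" "b + (p - b) = p"
      using False b j by (auto simp: eps_def)
    \<comment> \<open>The two indices add up to \<open>i + j\<close>, so this binomial has the same
      tail as \<open>phi p i j\<close>. The tails cancel in the bracket multiplied by the power of
      \<open>X_0\<close>.\<close>
    have "phi p (b + i + j - p) (p - b)
        = (var (b + i + j - p) * var (p - b) - var (tau p i j) * var (i + j - tau p i j) :: 'a mpoly)"
      unfolding phi_eq tau_def k ..
    then show ?thesis
      unfolding A_syz_def e using False le
      by (simp add: gen_map_add gen_map_diff gen_map_scale gen_map_PsiV gen_map_PhiV_le)
        (simp add: psi_def phi_eq[of p i] tau_def[of p i "b + j"] k algebra_simps)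
  qed
  then show ?thesis unfolding syzygy_module_def A_syz_def using le
    by (auto intro!: free_module_intros)
qed

text \<open>This is the Koszul syzygy of \<open>psi p d a b (p - b)\<close> and
  \<open>phi p i j\<close>.\<close>

lemma B_syz_in_syzygy_module:
  assumes "i \<in> {1..p-1}" "j \<in> {1..p-1}"
  shows "B_syz p d a b i j \<in> syzygy_module p d a b"
proof -
  have le: "i \<le> p" "j \<le> p" "eps p i j \<le> p" "i + j - eps p i j \<le> p"
    using assms by (auto simp: eps_def)
  have "gen_map p d a b (B_syz p d a b i j :: 'a vec) = 0"
    unfolding B_syz_def using le
    by (simp add: gen_map_diff gen_map_scale gen_map_PsiV gen_map_PhiV_le)
      (simp add: phi_def algebra_simps)
  moreover have "psi p d a b (p - b) \<in> ring_R p"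
    using b by (auto simp: psi_def intro!: free_module_intros)
  ultimately show ?thesis unfolding syzygy_module_def B_syz_def using le
    by (auto intro!: free_module_intros)
qed

lemma L_syz_in_syzygy_module:
  assumes "l \<in> {1..p-1}" "i \<in> {1..p-1}" "j \<in> {1..p-1}"
  shows "L_syz p l i j \<in> syzygy_module p d a b"
proof -
  have le: "l \<le> p" "i \<le> p" "j \<le> p" "tau p i j \<le> p" "tau p i l \<le> p"
    "i + j - tau p i j \<le> p" "i + l - tau p i l \<le> p"
    using assms by (auto simp: tau_def)
  have "gen_map p d a b (L_syz p l i j :: 'a vec) =
      var l * phi p i j - var j * phi p i l + var (tau p i j) * phi p (i + j - tau p i j) l
      - var (tau p i l) * phi p (i + l - tau p i l) j"
    unfolding L_syz_def using le
    by (simp add: gen_map_add gen_map_diff gen_map_scale gen_map_PhiV_le)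
  also have "\<dots> = 0"
    \<comment> \<open>Rewriting \<open>X_l * X_i * X_j\<close> by either route ends in a product
      depending only on \<open>n = i + j + l\<close>: \<open>X_0^2 * X_n\<close> for
      \<open>n < p\<close>, \<open>X_0 * X_p * X_(n-p)\<close> for \<open>p \<le> n < 2p\<close>,
      and \<open>X_p^2 * X_(n-2p)\<close> beyond.\<close>
    using assms unfolding phi_eq tau_def
    by (cases "i + j < p"; cases "i + l < p"; cases "i + j + l < p"; cases "i + j + l < 2 * p")
      (auto simp: algebra_simps)
  finally show ?thesis unfolding syzygy_module_def L_syz_def using le
    by (auto intro!: free_module_intros)
qed

section \<open>Leading terms of A, B and L\<close>

lemma gr_M_varpi_less: "gr_R p m (varpi p a b u) (varpi p a b u') \<Longrightarrow> gr_M p a b m u u'"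
  by (simp add: gr_M_def)

lemma gr_M_varpi_eq:
  "varpi p a b (t, e) = varpi p a b (t', e') \<Longrightarrow> gr_symb e e' \<Longrightarrow> gr_M p a b m (t, e) (t', e')"
  by (simp add: gr_M_def)

lemma lead_term_A_syz:
  assumes i: "i \<in> {1..p}" and j: "j < p - b"
  shows "lead_term p a b m (A_syz p d a b i j :: 'k::field vec)
    = Poly_Mapping.single (Psi j) (Poly_Mapping.single (x_mon i) 1)"
proof -
  let ?u = "(x_mon i, Psi j)" and ?P = "Poly_Mapping.single p a" and ?Z = "Poly_Mapping.single 0 (a + d)"
  let ?k = "b + i + j - p"
  let ?q = "b + i + j - eps p i (b + j)" and ?e = "eps p i (b + j)"
  let ?below = "below (gr_M p a b m) ?u"
  have bj: "b + j \<in> {1..p-1}" using b j by auto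
  have eb: "b + (?e - b) = ?e" using b by (auto simp: eps_def)
  have vu: "varpi p a b ?u = ?P + (x_mon i + x_mon (b + j))" by (simp add: ac_simps)
  have big: "gr_R p m (x_mon i + x_mon (b + j)) (x_mon ?e + x_mon ?q)" if "i < p"
    using gr_phi[OF _ bj, of i] that i
    by (auto simp: eps_def tau_def ac_simps split: if_splits)
  \<comment> \<open>For \<open>i < p\<close> this term has smaller \<open>varpi\<close>. For
    \<open>i = p\<close> the \<open>varpi\<close> values tie, and \<open>Psi j\<close> wins over
    \<open>Psi (p - b)\<close> because \<open>j < p - b\<close>.\<close>
  have 2: "gr_M p a b m ?u (x_mon ?q, Psi (?e - b))"
  proof (cases "i < p")
    case True
    have "varpi p a b (x_mon ?q, Psi (?e - b)) = ?P + (x_mon ?e + x_mon ?q)"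
      by (simp add: eb ac_simps)
    then show ?thesis using big[OF True]
      by (intro gr_M_varpi_less) (simp only: vu gr_R_add_left)
  next
    case False
    then have "i = p" "?e = p" "?q = b + j" using i by (auto simp: eps_def)
    then show ?thesis using b j by (intro gr_M_varpi_eq) (simp_all add: ac_simps)
  qed
  \<comment> \<open>The \<open>varpi\<close> values always tie here, and the term loses only because
    every \<open>Psi\<close> precedes every \<open>Phi\<close>.\<close>
  have 3: "gr_M p a b m ?u (?P, Phi (min i (b + j)) (max i (b + j)))"
    by (rule gr_M_varpi_eq) (use x_mon_min_max[of i "b + j"] in \<open>simp_all add: ac_simps\<close>)
  have 4: "gr_M p a b m ?u (?Z, Phi (min i j) (max i j))"
  proof (rule gr_M_varpi_less)
    have "varpi p a b ?u = x_mon i + (x_mon (b + j) + ?P)" by (simp add: ac_simps)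
    moreover have "varpi p a b (?Z, Phi (min i j) (max i j)) = x_mon i + (x_mon j + ?Z)"
      using x_mon_min_max[of i j] by (simp add: ac_simps)
    ultimately show "gr_R p m (varpi p a b ?u) (varpi p a b (?Z, Phi (min i j) (max i j)))"
      using gr_psi[of j] j by (simp only: gr_R_add_left)
  qed
  \<comment> \<open>A positive \<open>?k\<close> forces \<open>i + b + j > p\<close>. The comparison
    goes through \<open>X_p^(a+1) * X_k\<close>, which exceeds this term by \<open>gr_psi\<close>
    and is itself at most \<open>varpi\<close> of the leading term.\<close>
  have 5: "gr_M p a b m ?u (?Z, Phi (min ?k (p - b)) (max ?k (p - b)))" if k: "?k \<in> {1..p-1}"
  proof (rule gr_M_varpi_less)
    have e: "?e = p" "?q = ?k" using k by (auto simp: eps_def)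
    have "gr_R p m (x_mon p + ?P) (x_mon (p - b) + ?Z)" using gr_psi[of "p - b"] b by simp
    then have "gr_R p m (x_mon ?k + (x_mon p + ?P)) (x_mon ?k + (x_mon (p - b) + ?Z))"
      by (simp only: gr_R_add_left)
    moreover have "x_mon ?k + (x_mon p + ?P) = ?P + (x_mon ?e + x_mon ?q)"
      unfolding e by (simp add: ac_simps)
    moreover have "x_mon ?k + (x_mon (p - b) + ?Z)
        = varpi p a b (?Z, Phi (min ?k (p - b)) (max ?k (p - b)))"
      using x_mon_min_max[of ?k "p - b"] by (simp add: ac_simps)
    ultimately have g: "gr_R p m (?P + (x_mon ?e + x_mon ?q))
        (varpi p a b (?Z, Phi (min ?k (p - b)) (max ?k (p - b))))" by simp
    show "gr_R p m (varpi p a b ?u) (varpi p a b (?Z, Phi (min ?k (p - b)) (max ?k (p - b))))"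
    proof (cases "i < p")
      case True
      have "gr_R p m (varpi p a b ?u) (?P + (x_mon ?e + x_mon ?q))"
        unfolding vu gr_R_add_left by (rule big[OF True])
      then show ?thesis using g by (rule gr_R_trans)
    next
      case False
      then have "i = p" "?k = b + j" using i by auto
      then have "varpi p a b ?u = ?P + (x_mon ?e + x_mon ?q)" unfolding vu e by simp
      then show ?thesis using g by simp
    qed
  qed
  \<comment> \<open>Starting from 0 turns the negative first summand into a difference, so that
    \<open>below_diff\<close> applies throughout.\<close>
  let ?h = "(0 - var ?q *m PsiV (?e - b) - var p ^ a *m PhiV p i (b + j))
      + (var 0 ^ (a + d) *m PhiV p i j - var 0 ^ (a + d) *m PhiV p ?k (p - b)) :: 'k vec"
  have "A_syz p d a b i j = Poly_Mapping.single (Psi j) (Poly_Mapping.single (x_mon i) 1) + ?h"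
    unfolding A_syz_def scale_diff_right
    by (simp add: PsiV_def scale_single var_eq del: One_nat_def)
  moreover have "?below ?h"
    unfolding var_power
    unfolding var_eq
    by (intro below_add below_diff below_zero below_scale_PsiV below_scale_PhiV 2 3 4 5)
  ultimately show ?thesis using lead_term_single_add by metis
qed

text \<open>The other \<open>Psi\<close> term is smaller by \<open>gr_phi\<close>. Expanding
  \<open>psi\<close> gives two \<open>Phi\<close> terms: the one with \<open>X_p^(a+1)\<close> ties
  in \<open>varpi\<close> and loses by its symbol, the one with \<open>X_0^(a+d)\<close> is smaller
  by \<open>gr_psi\<close>.\<close>

lemma lead_term_B_syz:
  assumes "i \<in> {1..p-1}" "j \<in> {1..p-1}"
  shows "lead_term p a b m (B_syz p d a b i j :: 'k::field vec)
    = Poly_Mapping.single (Psi (p - b)) (Poly_Mapping.single (x_mon i + x_mon j) 1)"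
proof -
  let ?u = "(x_mon i + x_mon j, Psi (p - b))"
  let ?P = "Poly_Mapping.single p a" and ?Z = "Poly_Mapping.single 0 (a + d)"
  let ?e = "eps p i j" and ?q = "i + j - eps p i j" and ?s = "Phi (min i j) (max i j)"
  have pb: "b + (p - b) = p" using b by simp
  have vu: "varpi p a b ?u = (?P + x_mon p) + (x_mon i + x_mon j)" by (simp add: pb ac_simps)
  have mm: "varpi p a b (t, ?s) = t + (x_mon i + x_mon j)" for t
    using x_mon_min_max[of i j] by (simp add: ac_simps)
  have 2: "gr_M p a b m ?u (x_mon ?e + x_mon ?q, Psi (p - b))"
  proof (rule gr_M_varpi_less)
    have "varpi p a b (x_mon ?e + x_mon ?q, Psi (p - b)) = (?P + x_mon p) + (x_mon ?e + x_mon ?q)"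
      by (simp add: pb ac_simps)
    moreover have "gr_R p m (x_mon i + x_mon j) (x_mon ?e + x_mon ?q)"
      using gr_phi[OF assms] by (auto simp: eps_def tau_def ac_simps split: if_splits)
    ultimately show "gr_R p m (varpi p a b ?u) (varpi p a b (x_mon ?e + x_mon ?q, Psi (p - b)))"
      by (simp only: vu gr_R_add_left)
  qed
  have 3: "gr_M p a b m ?u (x_mon p + ?P, ?s)"
    by (rule gr_M_varpi_eq) (simp_all only: vu mm add.commute gr_symb.simps)
  have 4: "gr_M p a b m ?u (x_mon (p - b) + ?Z, ?s)"
  proof (rule gr_M_varpi_less)
    have "gr_R p m (x_mon p + ?P) (x_mon (p - b) + ?Z)"
      using gr_psi[of "p - b"] by (simp only: pb)
    then have "gr_R p m ((x_mon i + x_mon j) + (x_mon p + ?P)) ((x_mon i + x_mon j) + (x_mon (p - b) + ?Z))"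
      by (simp only: gr_R_add_left)
    then show "gr_R p m (varpi p a b ?u) (varpi p a b (x_mon (p - b) + ?Z, ?s))"
      unfolding vu mm by (simp only: ac_simps)
  qed
  let ?h = "(0 - (var ?e * var ?q) *m PsiV (p - b))
      - ((var p * var p ^ a) *m PhiV p i j - (var (p - b) * var 0 ^ (a + d)) *m PhiV p i j) :: 'k vec"
  have "B_syz p d a b i j
      = Poly_Mapping.single (Psi (p - b)) (Poly_Mapping.single (x_mon i + x_mon j) 1) + ?h"
    unfolding B_syz_def psi_def scale_diff_left pb
    by (simp add: PsiV_def scale_single var_eq mult_single del: One_nat_def)
  moreover have "below (gr_M p a b m) ?u ?h"
    unfolding var_power
    unfolding var_eq mult_single mult_1
    by (intro below_add below_diff below_zero below_scale_PsiV below_scale_PhiV 2 3 4)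
  ultimately show ?thesis using lead_term_single_add by metis
qed

lemma lead_term_L_syz:
  assumes l: "l \<in> {1..p-1}" and i: "i \<in> {1..p-1}" and j: "j \<in> {1..p-1}" and "i \<le> j" "l < j"
  shows "lead_term p a b m (L_syz p l i j :: 'k::field vec)
    = Poly_Mapping.single (Phi i j) (Poly_Mapping.single (x_mon l) 1)"
proof -
  let ?u = "(x_mon l, Phi i j)"
  let ?t = "tau p i j" and ?k = "i + j - tau p i j"
  let ?t' = "tau p i l" and ?k' = "i + l - tau p i l"
  have v: "varpi p a b (t, Phi (min r s) (max r s)) = t + (x_mon r + x_mon s)" for t r s
    using x_mon_min_max[of r s] by (simp add: ac_simps)
  \<comment> \<open>The \<open>varpi\<close> values tie. Either \<open>max i l < j\<close>, or
    \<open>i = j\<close> and the smaller index \<open>l\<close> is below \<open>i\<close>; both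
    clauses of the order on \<open>Phi\<close> are used.\<close>
  have 2: "gr_M p a b m ?u (x_mon j, Phi (min i l) (max i l))"
  proof (rule gr_M_varpi_eq)
    show "varpi p a b ?u = varpi p a b (x_mon j, Phi (min i l) (max i l))"
      unfolding v by (simp add: ac_simps)
  qed (use \<open>i \<le> j\<close> \<open>l < j\<close> in \<open>auto simp: max_def min_def\<close>)
  have 3: "gr_M p a b m ?u (x_mon ?t, Phi (min ?k l) (max ?k l))"
  proof (rule gr_M_varpi_less)
    have "gr_R p m (x_mon l + (x_mon i + x_mon j)) (x_mon l + (x_mon ?t + x_mon ?k))"
      using gr_phi[OF i j] by (simp only: gr_R_add_left)
    then show "gr_R p m (varpi p a b ?u) (varpi p a b (x_mon ?t, Phi (min ?k l) (max ?k l)))"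
      unfolding v by (simp add: ac_simps)
  qed
  have 4: "gr_M p a b m ?u (x_mon ?t', Phi (min ?k' j) (max ?k' j))"
  proof (rule gr_M_varpi_less)
    have "gr_R p m (x_mon j + (x_mon i + x_mon l)) (x_mon j + (x_mon ?t' + x_mon ?k'))"
      using gr_phi[OF i l] by (simp only: gr_R_add_left)
    then show "gr_R p m (varpi p a b ?u) (varpi p a b (x_mon ?t', Phi (min ?k' j) (max ?k' j)))"
      unfolding v by (simp add: ac_simps)
  qed
  let ?h = "(0 - var j *m PhiV p i l + var ?t *m PhiV p ?k l) - var ?t' *m PhiV p ?k' j :: 'k vec"
  have "L_syz p l i j = Poly_Mapping.single (Phi i j) (Poly_Mapping.single (x_mon l) 1) + ?h"
    unfolding L_syz_def using i j \<open>i \<le> j\<close>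
    by (simp add: PhiV_def[of p i j] min_absorb1 max_absorb2 scale_single var_eq del: One_nat_def)
  moreover have "below (gr_M p a b m) ?u ?h"
    unfolding var_eq by (intro below_add below_diff below_zero below_scale_PhiV 2 3 4)
  ultimately show ?thesis using lead_term_single_add by metis
qed

section \<open>The Groebner basis property\<close>

definition groebner_syzygies :: "'k::field vec set" where
  "groebner_syzygies = {A_syz p d a b i j | i j. i \<in> {1..p} \<and> j \<in> {0..<p - b}}
     \<union> {B_syz p d a b i j | i j. i \<in> {1..p - 1} \<and> j \<in> {1..p - 1}}
     \<union> {L_syz p l i j | l i j. l \<in> {1..p - 1} \<and> i \<in> {1..p - 1} \<and> j \<in> {1..p - 1} \<and>
          i \<le> j \<and> l < j}"

lemma finite_groebner_syzygies: "finite groebner_syzygies"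
proof -
  have "finite {A_syz p d a b i j | i j. i \<in> {1..p} \<and> j \<in> {0..<p - b}}"
    by (rule finite_subset[of _ "(\<lambda>(i, j). A_syz p d a b i j) ` ({1..p} \<times> {0..<p - b})"]) auto
  moreover have "finite {B_syz p d a b i j | i j. i \<in> {1..p - 1} \<and> j \<in> {1..p - 1}}"
    by (rule finite_subset[of _ "(\<lambda>(i, j). B_syz p d a b i j) ` ({1..p - 1} \<times> {1..p - 1})"]) auto
  moreover have "finite {L_syz p l i j | l i j. l \<in> {1..p - 1} \<and> i \<in> {1..p - 1} \<and> j \<in> {1..p - 1} \<and>
          i \<le> j \<and> l < j}"
    by (rule finite_subset[of _ "(\<lambda>(l, i, j). L_syz p l i j) ` ({1..p - 1} \<times> {1..p - 1} \<times> {1..p - 1})"])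
      force+
  ultimately show ?thesis unfolding groebner_syzygies_def by blast
qed

lemma groebner_syzygies_subset: "groebner_syzygies \<subseteq> syzygy_module p d a b"
proof
  fix g assume "g \<in> groebner_syzygies"
  then consider i j where "g = A_syz p d a b i j" "i \<in> {1..p}" "j < p - b"
    | i j where "g = B_syz p d a b i j" "i \<in> {1..p-1}" "j \<in> {1..p-1}"
    | l i j where "g = L_syz p l i j" "l \<in> {1..p-1}" "i \<in> {1..p-1}" "j \<in> {1..p-1}"
    unfolding groebner_syzygies_def by force
  then show "g \<in> syzygy_module p d a b"
    by cases (simp_all only: A_syz_in_syzygy_module B_syz_in_syzygy_module L_syz_in_syzygy_module)
qed

text \<open>In \<open>eq\<close>, the factors of \<open>varpi p a b (0, e')\<close> not shared with
  \<open>varpi p a b (0, e)\<close> must divide \<open>t\<close>. They always contain the variable,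
  or product of two variables, that leads some A, B or L at the symbol \<open>e\<close>.\<close>

lemma groebner_syzygies_lead_divides:
  assumes "e \<in> symbs p b" "e' \<in> symbs p b" "gr_symb e e'"
    and eq: "t + varpi p a b (0, e) = t' + varpi p a b (0, e')"
  shows "\<exists>g\<in>groebner_syzygies. \<exists>q s. t = q + s \<and>
    lead_term p a b m (g :: 'k::field vec) = Poly_Mapping.single e (Poly_Mapping.single s 1)"
proof -
  let ?P = "Poly_Mapping.single p a"
  have A: ?thesis if "e = Psi j" "j < p - b" "i \<in> {1..p}" "t = q + x_mon i" for i j q
  proof -
    have "(A_syz p d a b i j :: 'k vec) \<in> groebner_syzygies"
      unfolding groebner_syzygies_def
      by (rule UnI1, rule UnI1, intro CollectI exI conjI, rule refl) (use that in simp_all)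
    moreover have "lead_term p a b m (A_syz p d a b i j :: 'k vec)
        = Poly_Mapping.single e (Poly_Mapping.single (x_mon i) 1)"
      unfolding that(1) by (rule lead_term_A_syz) (use that in simp_all)
    ultimately show ?thesis using that(4) by (intro bexI exI conjI)
  qed
  have B: ?thesis if "e = Psi (p - b)" "i \<in> {1..p-1}" "j \<in> {1..p-1}" "t = q + (x_mon i + x_mon j)" for i j q
  proof -
    have "(B_syz p d a b i j :: 'k vec) \<in> groebner_syzygies"
      unfolding groebner_syzygies_def
      by (rule UnI1, rule UnI2, intro CollectI exI conjI, rule refl) (use that in simp_all)
    moreover have "lead_term p a b m (B_syz p d a b i j :: 'k vec)
        = Poly_Mapping.single e (Poly_Mapping.single (x_mon i + x_mon j) 1)"
      unfolding that(1) by (rule lead_term_B_syz) (use that in simp_all)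
    ultimately show ?thesis using that(4) by (intro bexI exI conjI)
  qed
  have L: ?thesis if "e = Phi i j" "l \<in> {1..p-1}" "i \<in> {1..p-1}" "j \<in> {1..p-1}" "i \<le> j" "l < j"
    "t = q + x_mon l" for i j l q
  proof -
    have "(L_syz p l i j :: 'k vec) \<in> groebner_syzygies"
      unfolding groebner_syzygies_def
      by (rule UnI2, intro CollectI exI conjI, rule refl) (use that in simp_all)
    moreover have "lead_term p a b m (L_syz p l i j :: 'k vec)
        = Poly_Mapping.single e (Poly_Mapping.single (x_mon l) 1)"
      unfolding that(1) by (rule lead_term_L_syz) (use that in simp_all)
    ultimately show ?thesis using that(7) by (intro bexI exI conjI)
  qed
  have swap: "\<exists>q. t = q + x_mon s" if "t + x_mon r = t' + x_mon s" "r \<noteq> s" for r s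
    using that by (intro divides_of_disjoint[of t "x_mon r" t']) auto
  consider (PsiPsi) i j where "e = Psi i" "e' = Psi j" "i < j" "j \<le> p - b"
    | (PsiPhi) i l j where "e = Psi i" "e' = Phi l j" "i \<le> p - b" "l \<in> {1..p-1}" "j \<in> {1..p-1}"
    | (PhiPhi) i j i' j' where "e = Phi i j" "e' = Phi i' j'" "i \<in> {1..p-1}" "j \<in> {1..p-1}" "i \<le> j"
      "i' \<in> {1..p-1}" "j' \<in> {1..p-1}" "i' \<le> j'" "j > j' \<or> j = j' \<and> i > i'"
    using assms(1-3) by (cases e; cases e') (auto simp: symbs_def)
  then show ?thesis
  proof cases
    case PsiPsi
    have "(t + x_mon (b + i)) + ?P = (t' + x_mon (b + j)) + ?P"
      using eq PsiPsi by (simp add: ac_simps)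
    then have "t + x_mon (b + i) = t' + x_mon (b + j)" by (rule add_right_imp_eq)
    then obtain q where "t = q + x_mon (b + j)"
      using swap[of "b + i" "b + j"] PsiPsi(3) by auto
    then show ?thesis using PsiPsi b by (intro A[of i "b + j" q]) auto
  next
    case PsiPhi
    show ?thesis
    \<comment> \<open>For \<open>i = p - b\<close> the head of \<open>psi\<close> is a pure power of
      \<open>X_p\<close>, disjoint from both \<open>X_l\<close> and \<open>X_j\<close>, so their
      product divides \<open>t\<close> and B applies. Otherwise a single variable suffices for
      A.\<close>
    proof (cases "i = p - b")
      case True
      have "t + (?P + x_mon p) = t' + (x_mon l + x_mon j)"
        using eq PsiPhi True b by (simp add: ac_simps)
      moreover have "Poly_Mapping.keys (?P + x_mon p) \<inter> Poly_Mapping.keys (x_mon l + x_mon j) = {}"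
        using PsiPhi by (auto simp: in_keys_iff lookup_add lookup_single when_def split: if_splits)
      ultimately have "\<exists>q. t = q + (x_mon l + x_mon j)" by (rule divides_of_disjoint)
      then obtain q where "t = q + (x_mon l + x_mon j)" ..
      then show ?thesis using PsiPhi True by (intro B) auto
    next
      case False
      then have bi: "b + i < p" "i < p - b" using PsiPhi b by auto
      have eq': "t + (?P + x_mon (b + i)) = t' + x_mon j + x_mon l"
        using eq PsiPhi by (simp add: ac_simps)
      show ?thesis
      \<comment> \<open>If \<open>l = b + i\<close>, then \<open>X_l\<close> may be shared with the
        head of \<open>psi\<close>. After cancelling it, \<open>X_j\<close> divides
        \<open>t\<close>, since \<open>j < p\<close> keeps it apart from
        \<open>X_p^a\<close>.\<close>
      proof (cases "l = b + i")
        case True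
        have "(t + ?P) + x_mon l = (t' + x_mon j) + x_mon l"
          using eq' True by (simp add: ac_simps)
        then have "t + ?P = t' + x_mon j" by (rule add_right_imp_eq)
        moreover have "Poly_Mapping.keys ?P \<inter> Poly_Mapping.keys (x_mon j) = {}"
          using PsiPhi by (auto simp: in_keys_iff lookup_single when_def split: if_splits)
        ultimately have "\<exists>q. t = q + x_mon j" by (rule divides_of_disjoint)
        then obtain q where "t = q + x_mon j" ..
        then show ?thesis using PsiPhi bi by (intro A[of i j q]) auto
      next
        case False
        have "Poly_Mapping.keys (?P + x_mon (b + i)) \<inter> Poly_Mapping.keys (x_mon l) = {}"
          using PsiPhi False by (auto simp: in_keys_iff lookup_add lookup_single when_def split: if_splits)
        with eq' have "\<exists>q. t = q + x_mon l" by (rule divides_of_disjoint)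
        then obtain q where "t = q + x_mon l" ..
        then show ?thesis using PsiPhi bi by (intro A[of i l q]) auto
      qed
    qed
  next
    case PhiPhi
    have eq': "t + (x_mon i + x_mon j) = t' + (x_mon i' + x_mon j')"
      using eq PhiPhi by (simp add: ac_simps)
    consider "j = j'" "i' < i" | "j' < j" "i' = i" | "j' < j" "i' \<noteq> i" using PhiPhi by blast
    then show ?thesis
    proof cases
      case 1
      then have "(t + x_mon i) + x_mon j = (t' + x_mon i') + x_mon j" using eq' by (simp add: ac_simps)
      then have "t + x_mon i = t' + x_mon i'" by (rule add_right_imp_eq)
      then obtain q where "t = q + x_mon i'" using swap[of i i'] 1 by auto
      then show ?thesis using PhiPhi 1 by (intro L[of i j i' q]) auto
    next
      case 2
      then have "(t + x_mon j) + x_mon i = (t' + x_mon j') + x_mon i" using eq' by (simp add: ac_simps)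
      then have "t + x_mon j = t' + x_mon j'" by (rule add_right_imp_eq)
      then obtain q where "t = q + x_mon j'" using swap[of j j'] 2 by auto
      then show ?thesis using PhiPhi 2 by (intro L[of i j j' q]) auto
    next
      \<comment> \<open>From \<open>i' \<le> j' < j\<close> and \<open>i' \<noteq> i\<close>, the
        variable \<open>X_i'\<close> differs from both \<open>X_i\<close> and \<open>X_j\<close>;
        the same chain gives the side condition \<open>i' < j\<close> of L.\<close>
      case 3
      have "t + (x_mon i + x_mon j) = (t' + x_mon j') + x_mon i'" using eq' by (simp add: ac_simps)
      moreover have "Poly_Mapping.keys (x_mon i + x_mon j) \<inter> Poly_Mapping.keys (x_mon i') = {}"
        using PhiPhi 3 by (auto simp: in_keys_iff lookup_add lookup_single when_def split: if_splits)
      ultimately have "\<exists>q. t = q + x_mon i'" by (rule divides_of_disjoint)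
      then obtain q where "t = q + x_mon i'" ..
      then show ?thesis using PhiPhi 3 by (intro L[of i j i' q]) auto
    qed
  qed
qed

lemma varpi_mons_R: "t \<in> mons_R p \<Longrightarrow> e \<in> symbs p b \<Longrightarrow> varpi p a b (t, e) \<in> mons_R p"
  using b by (auto simp: symbs_def intro!: mons_R_add mons_R_single)

lemma ex_lead_mon:
  assumes "v \<in> free_module p b" "v \<noteq> 0"
  obtains t e where "(t, e) \<in> supp_M v" "\<And>u. u \<in> supp_M v \<Longrightarrow> u \<noteq> (t, e) \<Longrightarrow> gr_M p a b m (t, e) u"
proof -
  have "\<exists>x\<in>supp_M v. \<forall>y\<in>supp_M v. y \<noteq> x \<longrightarrow> gr_M p a b m x y"
  proof (rule finite_strict_maximum)
    show "gr_M p a b m x z" if "gr_M p a b m x y" "gr_M p a b m y z" for x y z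
      using that by (rule gr_M_trans)
    show "gr_M p a b m x y \<or> gr_M p a b m y x" if "x \<in> supp_M v" "y \<in> supp_M v" "x \<noteq> y" for x y
    proof (rule gr_M_total)
      show "varpi p a b x \<in> mons_R p" "varpi p a b y \<in> mons_R p"
        using that varpi_mons_R supp_M_free_module[OF assms(1)] by (metis prod.collapse)+
    qed fact
  qed (use finite_supp_M supp_M_nonempty[OF assms(2)] in auto)
  then show ?thesis using that by (metis surj_pair)
qed

theorem groebner_basis_syzygy_module:
  "groebner_basis p a b m (syzygy_module p d a b :: 'k::field vec set) groebner_syzygies"
proof -
  let ?N = "syzygy_module p d a b :: 'k vec set"
  let ?LG = "lead_term p a b m ` (groebner_syzygies :: 'k vec set)"
  let ?LN = "lead_term p a b m ` (?N - {0})"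
  have LG: "?LG \<subseteq> H" if H: "is_submodule p b H" "?LN \<subseteq> H" for H
  proof
    fix w assume "w \<in> ?LG"
    then obtain g :: "'k vec" where g: "g \<in> ?N" "w = lead_term p a b m g"
      using groebner_syzygies_subset by blast
    show "w \<in> H"
    \<comment> \<open>By convention the leading term of 0 is 0, which lies in every
      submodule.\<close>
    proof (cases "g = 0")
      case True
      then show ?thesis using g H(1) by (simp add: lead_term_def is_submodule_def)
    next
      case False
      then show ?thesis using g H(2) by auto
    qed
  qed
  have LN: "?LN \<subseteq> H" if H: "is_submodule p b H" "?LG \<subseteq> H" for H
  proof
    fix w assume "w \<in> ?LN"
    then obtain v where v: "v \<in> ?N" "v \<noteq> 0" "w = lead_term p a b m v" by blast
    then have free: "v \<in> free_module p b" by (simp add: syzygy_module_def)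
    obtain t e where te: "(t, e) \<in> supp_M v"
      "\<And>u. u \<in> supp_M v \<Longrightarrow> u \<noteq> (t, e) \<Longrightarrow> gr_M p a b m (t, e) u"
      using ex_lead_mon[OF free v(2)] by blast
    let ?c = "Poly_Mapping.lookup (Poly_Mapping.lookup v e) t"
    have w: "w = Poly_Mapping.single e (Poly_Mapping.single t ?c)"
      using lead_mon_eqI[OF te] v by (simp add: lead_term_def)
    obtain t' e' where "e' \<in> symbs p b" "gr_symb e e'"
      "t + varpi p a b (0, e) = t' + varpi p a b (0, e')"
      using syzygy_lead_cancels[OF v(1) te] by blast
    then obtain g :: "'k vec" and q s where g: "g \<in> groebner_syzygies" "t = q + s"
      "lead_term p a b m g = Poly_Mapping.single e (Poly_Mapping.single s 1)"
      using groebner_syzygies_lead_divides[OF supp_M_free_module(2)[OF free te(1)], where ?'k = 'k]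
      by blast
    \<comment> \<open>The chosen \<open>g\<close> has leading coefficient 1, so the coefficient of
      \<open>w\<close> is carried by the monomial multiplier \<open>q\<close>.\<close>
    have "w = Poly_Mapping.single q ?c *m lead_term p a b m g"
      unfolding w g(2,3) by (simp add: scale_single mult_single)
    moreover have "Poly_Mapping.single q ?c \<in> ring_R p"
      using supp_M_free_module(1)[OF free te(1)] g(2) by (simp add: ring_R_single mons_R_add_iff)
    moreover have "lead_term p a b m g \<in> H" using g(1) H(2) by blast
    ultimately show "w \<in> H" using H(1) by (simp add: is_submodule_def)
  qed
  \<comment> \<open>By \<open>LG\<close> and \<open>LN\<close>, a submodule contains one set of
    leading terms iff it contains the other; both hulls intersect the same family.\<close>
  have "is_submodule p b hull ?LG = is_submodule p b hull ?LN"
    unfolding hull_def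
    by (rule arg_cong[where f = Inter], rule Collect_cong, rule conj_cong, rule refl, rule iffI)
      (erule (1) LN, erule (1) LG)
  then show ?thesis
    using finite_groebner_syzygies groebner_syzygies_subset by (simp add: groebner_basis_def)
qed

end

theorem theorem6p1:
  fixes p d a b :: nat and m :: "nat \<Rightarrow> nat"
  assumes "p \<ge> 2" and "d \<ge> 1"
    and "0 < m 0" and "\<forall>i<p. m i < m (Suc i)"
    and "\<forall>i\<in>{1..p}. m i = m 0 + i * d"
    and "m 0 = a * p + b" and "a \<ge> 1" and "b \<in> {1..p}"
    and "gcd (m 0) d = 1"
    and "minimal_generators (m ` {0..p})"
  shows "groebner_basis p a b m (syzygy_module p d a b :: 'k::field vec set)
    ({A_syz p d a b i j | i j. i \<in> {1..p} \<and> j \<in> {0..<p - b}}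
     \<union> {B_syz p d a b i j | i j. i \<in> {1..p - 1} \<and> j \<in> {1..p - 1}}
     \<union> {L_syz p l i j | l i j. l \<in> {1..p - 1} \<and> i \<in> {1..p - 1} \<and> j \<in> {1..p - 1} \<and>
          i \<le> j \<and> l < j})"
proof -
  interpret arithmetic_semigroup p d a b m
    by unfold_locales (use assms in auto)
  show ?thesis
    using groebner_basis_syzygy_module unfolding groebner_syzygies_def .
qed

end
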